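(* Let $T$ be the symmetric tridiagonal operator determined by sequences $a_n>0$, $b_n\in\mathbb{R}$ ($n\ge 1$). Suppose that $\lim_{n\to\infty}|b_n|=\infty$ and that for some real $r<1$ both $a_n=o(|b_n|^r)$ and $a_{n-1}=o(|b_n|^r)$ as $n\to\infty$. Then $T$ is self-adjoint and $\Lambda(T)=\sigma(T)$.
   Context: $(H,(\cdot,\cdot))$ is an infinite-dimensional complex Hilbert space with orthonormal basis $\{e_n\}_{n=1}^\infty$. Given real sequences $a_n>0$, $b_n\in\mathbb{R}$ ($n\ge1$), the formula $Te_n=a_ne_{n+1}+b_ne_n+a_{n-1}e_{n-1}$ (with $e_0=0$) defines a symmetric operator on the linear span of $\{e_n\}_{n=1}^\infty$; $T$ denotes the closure of this operator. $\sigma(T)$ is the spectrum of $T$. $T_N=P_NTP_N$ regarded as an operator on $H_N=\operatorname{span}\{e_1,\dots,e_N\}$, where $P_N$ is the orthogonal projection onto $H_N$. $\Lambda(T)$ is the set of all limit points of eigenvalues of $T_N$ as $N\to\infty$: $\lambda\in\Lambda(T)$ iff there is a sequence $\lambda_N\in\sigma(T_N)$ ($N\ge1$) having a subsequence converging to $\lambda$. The notation $y_n=o(z_n)$ means $\lim_{n\to\infty}y_n/z_n=0$. *)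

theory Defs
  imports "HOL-Analysis.Analysis"
begin

text \<open>Complex inner product spaces; the inner product is linear in its first argument. The
  real vector space structure, the norm and the topology are inherited from
  \<open>real_normed_vector\<close> and tied to the complex structure by \<open>scaleR_scaleC\<close> and \<open>cinner_norm\<close>.\<close>

class complex_inner = real_normed_vector +
  fixes scaleC :: "complex \<Rightarrow> 'a \<Rightarrow> 'a" (infixr \<open>*\<^sub>C\<close> 75)
    and cinner :: "'a \<Rightarrow> 'a \<Rightarrow> complex"
  assumes scaleC_add_right: "c *\<^sub>C (x + y) = c *\<^sub>C x + c *\<^sub>C y"
    and scaleC_add_left: "(c + d) *\<^sub>C x = c *\<^sub>C x + d *\<^sub>C x"
    and scaleC_scaleC: "c *\<^sub>C d *\<^sub>C x = (c * d) *\<^sub>C x"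
    and scaleC_one: "1 *\<^sub>C x = x"
    and scaleR_scaleC: "t *\<^sub>R x = complex_of_real t *\<^sub>C x"
    and cinner_commute: "cinner x y = cnj (cinner y x)"
    and cinner_add_left: "cinner (x + y) z = cinner x z + cinner y z"
    and cinner_scaleC_left: "cinner (c *\<^sub>C x) y = c * cinner x y"
    and cinner_norm: "cinner x x = complex_of_real ((norm x)\<^sup>2)"

class complex_hilbert = complex_inner + complete_space

interpretation complex_vector: vector_space "scaleC :: complex \<Rightarrow> 'a \<Rightarrow> 'a::complex_inner"
  by standard (simp_all add: scaleC_add_right scaleC_add_left scaleC_scaleC scaleC_one)

abbreviation cspan :: "'a::complex_inner set \<Rightarrow> 'a set"
  where "cspan \<equiv> module.span scaleC"

text \<open>Sequences are indexed by \<open>n \<ge> 1\<close>; values at index 0 are never used.\<close>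

definition orthonormal_basis :: "(nat \<Rightarrow> 'a::complex_inner) \<Rightarrow> bool"
  where "orthonormal_basis e \<longleftrightarrow>
    (\<forall>m\<ge>1. \<forall>n\<ge>1. cinner (e m) (e n) = (if m = n then 1 else 0)) \<and>
    closure (cspan (e ` {1..})) = UNIV"

definition orth_proj :: "'a::complex_inner set \<Rightarrow> 'a \<Rightarrow> 'a"
  where "orth_proj S x = (THE y. y \<in> S \<and> (\<forall>z\<in>S. cinner (x - y) z = 0))"

text \<open>A possibly unbounded, partially defined operator is represented by its graph, the set of
  pairs \<open>(x, T x)\<close> with \<open>x\<close> in the domain. The domain is thus \<open>fst ` T\<close>, and the closure of
  an operator is the topological closure of its graph.\<close>

definition is_operator :: "('a::complex_inner \<times> 'a) set \<Rightarrow> bool"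
  where "is_operator T \<longleftrightarrow> (0, 0) \<in> T \<and>
    (\<forall>(x, u)\<in>T. \<forall>(y, v)\<in>T. (x + y, u + v) \<in> T) \<and>
    (\<forall>c. \<forall>(x, u)\<in>T. (c *\<^sub>C x, c *\<^sub>C u) \<in> T) \<and>
    single_valued T"

definition adjoint_graph :: "('a::complex_inner \<times> 'a) set \<Rightarrow> ('a \<times> 'a) set"
  where "adjoint_graph T = {(y, v). \<forall>(x, u)\<in>T. cinner u y = cinner x v}"

definition self_adjoint :: "('a::complex_inner \<times> 'a) set \<Rightarrow> bool"
  where "self_adjoint T \<longleftrightarrow>
    is_operator T \<and> closure (fst ` T) = UNIV \<and> adjoint_graph T = T"

text \<open>The spectrum of an operator \<open>T\<close> acting in the space \<open>S\<close>, where \<open>S\<close> is the whole Hilbert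
  space or a closed subspace containing the domain and range of \<open>T\<close>. Since \<open>T\<close> is a graph, the
  first conjunct says that \<open>T - z\<close> maps the domain of \<open>T\<close> bijectively onto \<open>S\<close>, and the second
  that the inverse is bounded.\<close>

definition resolvent_set :: "'a::complex_inner set \<Rightarrow> ('a \<times> 'a) set \<Rightarrow> complex set"
  where "resolvent_set S T = {z. bij_betw (\<lambda>(x, u). u - z *\<^sub>C x) T S \<and>
    (\<exists>C. \<forall>(x, u)\<in>T. norm x \<le> C * norm (u - z *\<^sub>C x))}"

definition op_spectrum :: "'a::complex_inner set \<Rightarrow> ('a \<times> 'a) set \<Rightarrow> complex set"
  where "op_spectrum S T = - resolvent_set S T"

definition tridiag_basis :: "(nat \<Rightarrow> real) \<Rightarrow> (nat \<Rightarrow> real) \<Rightarrow> (nat \<Rightarrow> 'a::complex_inner) \<Rightarrow> nat \<Rightarrow> 'a"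
  where "tridiag_basis a b e n = a n *\<^sub>R e (n + 1) + b n *\<^sub>R e n +
    (if n = 1 then 0 else a (n - 1) *\<^sub>R e (n - 1))"

text \<open>The linear extension of \<open>tridiag_basis\<close> to the linear span of the basis, and its closure.\<close>

definition tridiag_span ::
    "(nat \<Rightarrow> real) \<Rightarrow> (nat \<Rightarrow> real) \<Rightarrow> (nat \<Rightarrow> 'a::complex_inner) \<Rightarrow> ('a \<times> 'a) set"
  where "tridiag_span a b e =
    {(\<Sum>n=1..N. c n *\<^sub>C e n, \<Sum>n=1..N. c n *\<^sub>C tridiag_basis a b e n) | c N. True}"

definition tridiag ::
    "(nat \<Rightarrow> real) \<Rightarrow> (nat \<Rightarrow> real) \<Rightarrow> (nat \<Rightarrow> 'a::complex_inner) \<Rightarrow> ('a \<times> 'a) set"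
  where "tridiag a b e = closure (tridiag_span a b e)"

definition trunc_space :: "(nat \<Rightarrow> 'a::complex_inner) \<Rightarrow> nat \<Rightarrow> 'a set"
  where "trunc_space e N = cspan (e ` {1..N})"

text \<open>The operator \<open>P\<^sub>N T P\<^sub>N\<close> on \<open>trunc_space e N\<close>, for \<open>P\<^sub>N\<close> the projection onto that space.\<close>

definition truncation ::
    "(nat \<Rightarrow> 'a::complex_inner) \<Rightarrow> ('a \<times> 'a) set \<Rightarrow> nat \<Rightarrow> ('a \<times> 'a) set"
  where "truncation e T N =
    {(x, orth_proj (trunc_space e N) u) | x u.
      x \<in> trunc_space e N \<and> (orth_proj (trunc_space e N) x, u) \<in> T}"

definition limit_spectrum :: "(nat \<Rightarrow> 'a::complex_inner) \<Rightarrow> ('a \<times> 'a) set \<Rightarrow> complex set"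
  where "limit_spectrum e T = {z. \<exists>l :: nat \<Rightarrow> complex.
    (\<forall>N\<ge>1. l N \<in> op_spectrum (trunc_space e N) (truncation e T N)) \<and>
    (\<exists>s :: nat \<Rightarrow> nat. strict_mono s \<and> (l \<circ> s) \<longlonglongrightarrow> z)}"

end

theory Submission imports Defs begin

text \<open>The hypotheses give \<open>a\<^sub>n = o(|b\<^sub>n|)\<close> and \<open>a\<^sub>n\<^sub>-\<^sub>1 = o(|b\<^sub>n|)\<close>. Hence, for bounded \<open>z\<close>, a solution
  \<open>x\<close> of \<open>((T\<^sub>N - z) x)\<^sub>n = 0\<close>, \<open>n\<^sub>0 < n \<le> N\<close>, satisfies \<open>a\<^sub>N |x\<^sub>N| \<le> 3\<^bsup>-(N-n\<^sub>0)\<^esup> a\<^sub>n\<^sub>0 \<parallel>x\<parallel>\<close>, and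
  \<open>a\<^sub>N x\<^sub>N e\<^sub>N\<^sub>+\<^sub>1\<close> is exactly the difference of \<open>T x\<close> and \<open>T\<^sub>N x\<close>.
  For nonreal \<open>z\<close>, solving \<open>(T\<^sub>N - z) x = e\<^sub>k\<close> and letting \<open>N \<rightarrow> \<infinity>\<close> shows that \<open>T - z\<close> has dense range,
  so \<open>T\<close> is self-adjoint. Eigenvectors of \<open>T\<^sub>N\<close> for eigenvalues tending to \<open>z\<close> are approximate
  eigenvectors of \<open>T\<close>, so limit points lie in the spectrum. Conversely, an approximate eigenvector
  of \<open>T\<close> at \<open>z\<close> can be taken in some \<open>H\<^sub>M\<close>, where \<open>T\<^sub>N\<close> agrees with \<open>T\<close> for \<open>N > M\<close>; as \<open>T\<^sub>N\<close> is
  Hermitian, it then has an eigenvalue close to \<open>z\<close>.\<close>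

subsection \<open>Complex inner products\<close>

lemma cinner_add_right: "cinner x (y + z) = cinner x y + cinner x z"
  by (metis cinner_add_left cinner_commute complex_cnj_add)

lemma cinner_scaleC_right: "cinner x (c *\<^sub>C y) = cnj c * cinner x y"
  by (metis cinner_scaleC_left cinner_commute complex_cnj_mult)

lemma norm_scaleC: "norm (c *\<^sub>C x) = norm c * norm (x::'a::complex_inner)"
proof -
  have "complex_of_real ((norm (c *\<^sub>C x))\<^sup>2) = complex_of_real ((norm c * norm x)\<^sup>2)"
    unfolding cinner_norm[symmetric] cinner_scaleC_left cinner_scaleC_right power_mult_distrib
      of_real_mult complex_norm_square[of c] by (simp add: cinner_norm mult_ac)
  then show ?thesis
    by (metis norm_ge_zero of_real_eq_iff power2_eq_iff_nonneg zero_le_mult_iff)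
qed

lemma Re_cinner_self: "Re (cinner x x) = (norm x)\<^sup>2"
  by (simp add: cinner_norm)

lemma cinner_zero_left [simp]: "cinner 0 y = 0"
  by (metis add.right_neutral add_left_cancel cinner_add_left)

lemma cinner_zero_right [simp]: "cinner y 0 = 0"
  by (metis add.right_neutral add_left_cancel cinner_add_right)

lemma norm_add_sqr:
  "(norm (x + y))\<^sup>2 = (norm x)\<^sup>2 + 2 * Re (cinner x y) + (norm (y::'a::complex_inner))\<^sup>2"
proof -
  have "Re (cinner y x) = Re (cinner x y)"
    by (metis cinner_commute complex_cnj(1) cnj.simps(1))
  then show ?thesis
    unfolding Re_cinner_self[symmetric] by (simp add: cinner_add_left cinner_add_right)
qed

lemma cinner_Cauchy_Schwarz: "norm (cinner x y) \<le> norm x * norm (y::'a::complex_inner)"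
proof (cases "y = 0")
  case False
  \<comment> \<open>With this \<open>k\<close> the vector \<open>x + k *\<^sub>C y\<close> is the
    component of \<open>x\<close> orthogonal to \<open>y\<close>; that its squared norm is
    nonnegative is the inequality.\<close>
  define k where "k = - cinner x y / complex_of_real ((norm y)\<^sup>2)"
  have ny: "norm y > 0" using False by simp
  have "0 \<le> (norm (x + k *\<^sub>C y))\<^sup>2" by simp
  also have "\<dots> = (norm x)\<^sup>2 - (norm (cinner x y))\<^sup>2 / (norm y)\<^sup>2"
  proof -
    have "cnj k * cinner x y = - complex_of_real ((norm (cinner x y))\<^sup>2 / (norm y)\<^sup>2)"
      unfolding of_real_divide complex_norm_square[of "cinner x y"] by (simp add: k_def mult.commute)
    then have "Re (cinner x (k *\<^sub>C y)) = - ((norm (cinner x y))\<^sup>2 / (norm y)\<^sup>2)"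
      by (metis Re_complex_of_real cinner_scaleC_right of_real_minus)
    moreover have "(norm (k *\<^sub>C y))\<^sup>2 = (norm (cinner x y))\<^sup>2 / (norm y)\<^sup>2"
      using ny unfolding norm_scaleC k_def norm_divide norm_of_real
      by (simp add: field_simps power2_eq_square)
    ultimately show ?thesis by (simp add: norm_add_sqr)
  qed
  finally have "(norm (cinner x y))\<^sup>2 \<le> (norm x * norm y)\<^sup>2"
    using ny by (simp add: field_simps power_mult_distrib)
  then show ?thesis by (simp add: power2_le_iff_abs_le)
qed simp

lemma bounded_bilinear_cinner: "bounded_bilinear (cinner :: 'a::complex_inner \<Rightarrow> 'a \<Rightarrow> complex)"
proof
  show "\<exists>K. \<forall>x y::'a. norm (cinner x y) \<le> norm x * norm y * K"
    using cinner_Cauchy_Schwarz by (intro exI[of _ 1]) auto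
qed (simp_all add: cinner_add_left cinner_add_right cinner_scaleC_left cinner_scaleC_right
    scaleR_scaleC scaleR_conv_of_real)

interpretation cinner: bounded_bilinear "cinner :: 'a::complex_inner \<Rightarrow> 'a \<Rightarrow> complex"
  by (rule bounded_bilinear_cinner)

interpretation scaleC: bounded_bilinear "scaleC :: complex \<Rightarrow> 'a::complex_inner \<Rightarrow> 'a"
proof
  show "\<exists>K. \<forall>c (x::'a). norm (c *\<^sub>C x) \<le> norm c * norm x * K"
    by (intro exI[of _ 1]) (simp add: norm_scaleC)
qed (simp_all add: scaleC_add_right scaleC_add_left scaleR_scaleC scaleC_scaleC
    scaleR_conv_of_real mult.commute)

lemmas tendsto_cinner = cinner.tendsto
lemmas tendsto_scaleC = scaleC.tendsto

lemma cinner_self_eq_0: "cinner x x = 0 \<longleftrightarrow> x = 0"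
  by (simp add: cinner_norm)

text \<open>Approximate \<open>w\<close> itself from \<open>D\<close>: the vanishing products
  converge to \<open>cinner w w\<close>.\<close>

lemma orthogonal_dense_eq_0:
  assumes "closure D = (UNIV :: 'a::complex_inner set)" and "\<And>x. x \<in> D \<Longrightarrow> cinner x w = 0"
  shows "w = 0"
proof -
  from assms(1) obtain f where f: "\<And>n. f n \<in> D" "f \<longlonglongrightarrow> w"
    by (metis UNIV_I closure_sequential)
  have "(\<lambda>n. cinner (f n) w) \<longlonglongrightarrow> cinner w w"
    by (intro tendsto_cinner f tendsto_const)
  then have "cinner w w = 0"
    using f(1) assms(2) by (simp add: LIMSEQ_const_iff)
  then show ?thesis by (simp add: cinner_self_eq_0)
qed

lemma subspace_closure:
  assumes "complex_vector.subspace (R :: 'a::complex_inner set)"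
  shows "complex_vector.subspace (closure R)"
  unfolding complex_vector.subspace_def
proof (intro conjI ballI allI)
  show "0 \<in> closure R"
    using complex_vector.subspace_0[OF assms] closure_subset by blast
next
  fix x y assume "x \<in> closure R" "y \<in> closure R"
  then obtain f g where fg: "\<And>n. f n \<in> R" "f \<longlonglongrightarrow> x" "\<And>n. g n \<in> R" "g \<longlonglongrightarrow> y"
    unfolding closure_sequential by blast
  then show "x + y \<in> closure R"
    unfolding closure_sequential using complex_vector.subspace_add[OF assms]
    by (intro exI[of _ "\<lambda>n. f n + g n"]) (auto intro: tendsto_add)
next
  fix c x assume "x \<in> closure R"
  then obtain f where f: "\<And>n. f n \<in> R" "f \<longlonglongrightarrow> x"
    unfolding closure_sequential by blast
  then show "c *\<^sub>C x \<in> closure R"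
    unfolding closure_sequential using complex_vector.subspace_scale[OF assms]
    by (intro exI[of _ "\<lambda>n. c *\<^sub>C f n"]) (auto intro: tendsto_scaleC)
qed

subsection \<open>Closed symmetric operators\<close>

text \<open>\<open>is_operator\<close> without single-valuedness, so that it passes to closures of
  graphs not yet known to be operators.\<close>

definition linear_graph :: "('a::complex_inner \<times> 'a) set \<Rightarrow> bool"
  where "linear_graph T \<longleftrightarrow> (0, 0) \<in> T \<and>
    (\<forall>x u y v. (x, u) \<in> T \<longrightarrow> (y, v) \<in> T \<longrightarrow> (x + y, u + v) \<in> T) \<and>
    (\<forall>c x u. (x, u) \<in> T \<longrightarrow> (c *\<^sub>C x, c *\<^sub>C u) \<in> T)"

text \<open>The inclusion of \<open>T\<close> in \<open>adjoint_graph T\<close>, in a form that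
  passes to limits.\<close>

definition symmetric_graph :: "('a::complex_inner \<times> 'a) set \<Rightarrow> bool"
  where "symmetric_graph T \<longleftrightarrow>
    (\<forall>x u y v. (x, u) \<in> T \<longrightarrow> (y, v) \<in> T \<longrightarrow> cinner u y = cinner x v)"

lemma closure_Pair_sequential:
  fixes S :: "('a::real_normed_vector \<times> 'b::real_normed_vector) set"
  shows "(x, u) \<in> closure S \<longleftrightarrow>
    (\<exists>f g. (\<forall>n. (f n, g n) \<in> S) \<and> f \<longlonglongrightarrow> x \<and> g \<longlonglongrightarrow> u)"
proof
  assume "(x, u) \<in> closure S"
  then obtain h where h: "\<And>n. h n \<in> S" "h \<longlonglongrightarrow> (x, u)"
    by (auto simp: closure_sequential)
  show "\<exists>f g. (\<forall>n. (f n, g n) \<in> S) \<and> f \<longlonglongrightarrow> x \<and> g \<longlonglongrightarrow> u"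
    using h tendsto_fst[OF h(2)] tendsto_snd[OF h(2)]
    by (intro exI[of _ "\<lambda>n. fst (h n)"] exI[of _ "\<lambda>n. snd (h n)"]) auto
next
  assume "\<exists>f g. (\<forall>n. (f n, g n) \<in> S) \<and> f \<longlonglongrightarrow> x \<and> g \<longlonglongrightarrow> u"
  then show "(x, u) \<in> closure S"
    unfolding closure_sequential
  proof (elim exE conjE)
    fix f g assume "\<forall>n. (f n, g n) \<in> S" "f \<longlonglongrightarrow> x" "g \<longlonglongrightarrow> u"
    then show "\<exists>h. (\<forall>n. h n \<in> S) \<and> h \<longlonglongrightarrow> (x, u)"
      by (intro exI[of _ "\<lambda>n. (f n, g n)"]) (auto intro: tendsto_Pair)
  qed
qed

lemma linear_graph_closure:
  assumes "linear_graph S"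
  shows "linear_graph (closure S)"
proof -
  have zero: "(0, 0) \<in> closure S"
    using assms closure_subset[of S] by (auto simp: linear_graph_def)
  have add: "(x + y, u + v) \<in> closure S" if xu: "(x, u) \<in> closure S" and yv: "(y, v) \<in> closure S"
    for x u y v
  proof -
    obtain f g where fg: "\<And>n. (f n, g n) \<in> S" "f \<longlonglongrightarrow> x" "g \<longlonglongrightarrow> u"
      using xu unfolding closure_Pair_sequential by auto
    obtain f' g' where fg': "\<And>n. (f' n, g' n) \<in> S" "f' \<longlonglongrightarrow> y" "g' \<longlonglongrightarrow> v"
      using yv unfolding closure_Pair_sequential by auto
    have "\<forall>n. (f n + f' n, g n + g' n) \<in> S"
      using assms fg(1) fg'(1) by (simp add: linear_graph_def)
    then show ?thesis
      unfolding closure_Pair_sequential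
      using tendsto_add[OF fg(2) fg'(2)] tendsto_add[OF fg(3) fg'(3)]
      by (intro exI[of _ "\<lambda>n. f n + f' n"] exI[of _ "\<lambda>n. g n + g' n"]) simp
  qed
  have scale: "(c *\<^sub>C x, c *\<^sub>C u) \<in> closure S" if xu: "(x, u) \<in> closure S" for c x u
  proof -
    obtain f g where fg: "\<And>n. (f n, g n) \<in> S" "f \<longlonglongrightarrow> x" "g \<longlonglongrightarrow> u"
      using xu unfolding closure_Pair_sequential by auto
    have "\<forall>n. (c *\<^sub>C f n, c *\<^sub>C g n) \<in> S"
      using assms fg(1) by (simp add: linear_graph_def)
    then show ?thesis
      unfolding closure_Pair_sequential
      using tendsto_scaleC[OF tendsto_const fg(2)] tendsto_scaleC[OF tendsto_const fg(3)]
      by (intro exI[of _ "\<lambda>n. c *\<^sub>C f n"] exI[of _ "\<lambda>n. c *\<^sub>C g n"]) simp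
  qed
  show ?thesis unfolding linear_graph_def using zero add scale by blast
qed

lemma symmetric_graph_closure:
  assumes "symmetric_graph S"
  shows "symmetric_graph (closure S)"
  unfolding symmetric_graph_def
proof (intro allI impI)
  fix x u y v assume xu: "(x, u) \<in> closure S" and yv: "(y, v) \<in> closure S"
  obtain f g where fg: "\<And>n. (f n, g n) \<in> S" "f \<longlonglongrightarrow> x" "g \<longlonglongrightarrow> u"
    using xu unfolding closure_Pair_sequential by auto
  obtain f' g' where fg': "\<And>n. (f' n, g' n) \<in> S" "f' \<longlonglongrightarrow> y" "g' \<longlonglongrightarrow> v"
    using yv unfolding closure_Pair_sequential by auto
  have "(\<lambda>n. cinner (g n) (f' n)) \<longlonglongrightarrow> cinner u y"
    by (intro tendsto_cinner fg fg')
  moreover have "(\<lambda>n. cinner (f n) (g' n)) \<longlonglongrightarrow> cinner x v"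
    by (intro tendsto_cinner fg fg')
  moreover have "cinner (g n) (f' n) = cinner (f n) (g' n)" for n
    using assms fg(1) fg'(1) by (auto simp: symmetric_graph_def)
  ultimately show "cinner u y = cinner x v"
    using LIMSEQ_unique by auto
qed

lemma linear_graph_diff:
  assumes "linear_graph T" "(x, u) \<in> T" "(y, v) \<in> T"
  shows "(x - y, u - v) \<in> T"
proof -
  have "(-1) *\<^sub>C z = - z" for z :: 'a
    by (simp add: complex_vector.scale_minus_left scaleC_one)
  then have "(- y, - v) \<in> T"
    using assms unfolding linear_graph_def by metis
  then have "(x + - y, u + - v) \<in> T"
    using assms unfolding linear_graph_def by blast
  then show ?thesis by simp
qed

section \<open>Lower bounds, resolvents and the criterion for self-adjointness\<close>

lemma symmetric_cinner_real:
  assumes "symmetric_graph T" "(x, u) \<in> T"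
  shows "Im (cinner u x) = 0"
proof -
  have "cinner u x = cnj (cinner u x)"
    using assms by (metis cinner_commute symmetric_graph_def)
  then show ?thesis by (metis cnj.simps(2) neg_equal_zero)
qed

text \<open>Pair \<open>u - z *\<^sub>C x\<close> with \<open>x\<close>: the imaginary part is
  \<open>- Im z * (norm x)\<^sup>2\<close>, and Cauchy-Schwarz finishes. Speaking of two vectors
  only, it serves both \<open>T\<close> and its finite sections.\<close>

lemma norm_shift_ge:
  assumes "Im (cinner u x) = 0"
  shows "\<bar>Im z\<bar> * norm x \<le> norm (u - z *\<^sub>C x)"
proof (cases "x = 0")
  case False
  have "Im (cinner (u - z *\<^sub>C x) x) = - Im z * (norm x)\<^sup>2"
    using assms by (simp add: cinner.diff_left cinner_scaleC_left cinner_norm)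
  then have "\<bar>Im z\<bar> * (norm x)\<^sup>2 \<le> norm (cinner (u - z *\<^sub>C x) x)"
    by (metis abs_Im_le_cmod abs_minus_cancel abs_mult abs_power2 mult_minus_left)
  also have "\<dots> \<le> norm (u - z *\<^sub>C x) * norm x"
    by (rule cinner_Cauchy_Schwarz)
  finally show ?thesis
    using False by (simp add: power2_eq_square)
qed simp

text \<open>By the lower bound, convergence of the images \<open>u - z *\<^sub>C x\<close> makes the
  arguments \<open>x\<close> a Cauchy sequence, and closedness puts the limit pair back into
  \<open>T\<close>.\<close>

lemma surj_if_closed_dense_range:
  fixes T :: "('a::complex_hilbert \<times> 'a) set"
  assumes T: "linear_graph T" "closed T" and c: "c > 0"
    and below: "\<And>x u. (x, u) \<in> T \<Longrightarrow> c * norm x \<le> norm (u - z *\<^sub>C x)"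
    and dense: "y \<in> closure ((\<lambda>(x, u). u - z *\<^sub>C x) ` T)"
  shows "\<exists>(x, u)\<in>T. u - z *\<^sub>C x = y"
proof -
  obtain h where h: "\<And>n. h n \<in> (\<lambda>(x, u). u - z *\<^sub>C x) ` T" "h \<longlonglongrightarrow> y"
    using dense by (auto simp: closure_sequential)
  then have "\<forall>n. \<exists>x u. (x, u) \<in> T \<and> h n = u - z *\<^sub>C x" by force
  then obtain f g where fg: "\<And>n. (f n, g n) \<in> T" "\<And>n. h n = g n - z *\<^sub>C f n" by metis
  have "Cauchy f"
  proof (rule metric_CauchyI)
    fix r :: real assume "r > 0"
    then have "r * c > 0" using c by simp
    then obtain M where M: "\<And>m n. m \<ge> M \<Longrightarrow> n \<ge> M \<Longrightarrow> dist (h m) (h n) < r * c"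
      using metric_CauchyD[OF LIMSEQ_imp_Cauchy[OF h(2)]] by blast
    have "dist (f m) (f n) < r" if "m \<ge> M" "n \<ge> M" for m n
    proof -
      have "c * norm (f m - f n) \<le> norm ((g m - g n) - z *\<^sub>C (f m - f n))"
        by (rule below) (intro linear_graph_diff T fg)
      also have "(g m - g n) - z *\<^sub>C (f m - f n) = h m - h n"
        by (simp add: fg(2) scaleC.diff_right)
      also have "norm \<dots> < r * c" using M that by (simp add: dist_norm)
      finally show ?thesis using c by (simp add: dist_norm mult.commute)
    qed
    then show "\<exists>M. \<forall>m\<ge>M. \<forall>n\<ge>M. dist (f m) (f n) < r" by blast
  qed
  then obtain x where x: "f \<longlonglongrightarrow> x"
    using Cauchy_convergent_iff convergent_def by blast
  have "(\<lambda>n. h n + z *\<^sub>C f n) \<longlonglongrightarrow> y + z *\<^sub>C x"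
    by (intro tendsto_add h tendsto_scaleC x tendsto_const)
  then have "g \<longlonglongrightarrow> y + z *\<^sub>C x" using fg(2) by simp
  then have "(x, y + z *\<^sub>C x) \<in> closure T"
    unfolding closure_Pair_sequential using fg x by blast
  then show ?thesis using T(2) by (force simp: closure_closed)
qed

lemma mem_resolvent_set_UNIV:
  assumes T: "linear_graph T" and c: "c > 0"
    and below: "\<And>x u. (x, u) \<in> T \<Longrightarrow> c * norm x \<le> norm (u - z *\<^sub>C x)"
    and surj: "\<And>y. \<exists>(x, u)\<in>T. u - z *\<^sub>C x = y"
  shows "z \<in> resolvent_set UNIV T"
proof -
  have "inj_on (\<lambda>(x, u). u - z *\<^sub>C x) T"
  proof (rule inj_onI, clarify)
    fix x u y v assume xu: "(x, u) \<in> T" and yv: "(y, v) \<in> T" and eq: "u - z *\<^sub>C x = v - z *\<^sub>C y"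
    have "(u - v) - z *\<^sub>C (x - y) = 0"
      using eq by (simp add: scaleC.diff_right algebra_simps)
    then have "c * norm (x - y) \<le> 0"
      using below[OF linear_graph_diff[OF T xu yv]] by simp
    then have "x = y"
      using c by (simp add: mult_le_0_iff)
    then show "x = y \<and> u = v" using eq by simp
  qed
  moreover have "(\<lambda>(x, u). u - z *\<^sub>C x) ` T = UNIV"
  proof (intro equalityI subsetI)
    fix y show "y \<in> (\<lambda>(x, u). u - z *\<^sub>C x) ` T"
      using surj[of y] by (auto intro!: rev_image_eqI)
  qed simp
  moreover have "norm x \<le> 1 / c * norm (u - z *\<^sub>C x)" if "(x, u) \<in> T" for x u
    using below[OF that] c by (simp add: field_simps)
  ultimately show ?thesis
    unfolding resolvent_set_def bij_betw_def by blast
qed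

lemma symmetric_nonreal_resolvent:
  fixes T :: "('a::complex_hilbert \<times> 'a) set"
  assumes T: "linear_graph T" "closed T" "symmetric_graph T" and z: "Im z \<noteq> 0"
    and dense: "closure ((\<lambda>(x, u). u - z *\<^sub>C x) ` T) = UNIV"
  shows "\<exists>(x, u)\<in>T. u - z *\<^sub>C x = y" and "z \<in> resolvent_set UNIV T"
proof -
  have below: "\<bar>Im z\<bar> * norm x \<le> norm (u - z *\<^sub>C x)" if "(x, u) \<in> T" for x u
    by (rule norm_shift_ge) (rule symmetric_cinner_real[OF T(3) that])
  have pos: "\<bar>Im z\<bar> > 0" using z by simp
  show "\<exists>(x, u)\<in>T. u - z *\<^sub>C x = y" for y
    by (rule surj_if_closed_dense_range[OF T(1,2) pos below]) (auto simp: dense)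
  then show "z \<in> resolvent_set UNIV T"
    by (intro mem_resolvent_set_UNIV[OF T(1) pos below])
qed

text \<open>The classical criterion through the ranges of \<open>T - \<i>\<close> and
  \<open>T + \<i>\<close>: the first yields a candidate in \<open>T\<close> for each pair of the
  adjoint, the second shows that the two agree.\<close>

lemma self_adjointI:
  fixes T :: "('a::complex_hilbert \<times> 'a) set"
  assumes T: "linear_graph T" "symmetric_graph T" and dom: "closure (fst ` T) = UNIV"
    and surj: "\<And>z y. Im z \<noteq> 0 \<Longrightarrow> \<exists>(x, u)\<in>T. u - z *\<^sub>C x = y"
  shows "self_adjoint T"
proof -
  have "single_valued T"
  proof (rule single_valuedI)
    fix x u v assume "(x, u) \<in> T" "(x, v) \<in> T"
    \<comment> \<open>By symmetry a value of \<open>T\<close> at 0 is orthogonal to the dense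
      domain.\<close>
    then have uv: "(0, u - v) \<in> T" using linear_graph_diff[OF T(1)] by fastforce
    have "cinner y (u - v) = 0" if y: "y \<in> fst ` T" for y
    proof -
      obtain w where "(y, w) \<in> T" using y unfolding fst_eq_Domain by (rule DomainE)
      then have "cinner w 0 = cinner y (u - v)"
        using T(2) uv unfolding symmetric_graph_def by blast
      then show ?thesis by simp
    qed
    then show "u = v"
      using orthogonal_dense_eq_0[OF dom, of "u - v"] by simp
  qed
  moreover have "adjoint_graph T \<subseteq> T"
  proof clarify
    fix y v assume "(y, v) \<in> adjoint_graph T"
    then have adj: "cinner u y = cinner x v" if "(x, u) \<in> T" for x u
      using that by (auto simp: adjoint_graph_def)
    obtain x u where xu: "(x, u) \<in> T" "u - \<i> *\<^sub>C x = v - \<i> *\<^sub>C y"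
      using surj[of \<i> "v - \<i> *\<^sub>C y"] by auto
    have vu: "v - u = \<i> *\<^sub>C (y - x)"
      using xu(2) by (simp add: scaleC.diff_right algebra_simps)
    \<comment> \<open>The pair \<open>(y - x, v - u)\<close> lies in the adjoint with
      \<open>v - u = \<i> *\<^sub>C (y - x)\<close>, so \<open>y - x\<close> is orthogonal to the
      range of \<open>T + \<i>\<close>. Solving for \<open>y - x\<close> itself makes it orthogonal
      to itself.\<close>
    obtain x' u' where x'u': "(x', u') \<in> T" "u' - (- \<i>) *\<^sub>C x' = y - x"
      using surj[of "- \<i>" "y - x"] by auto
    have "cinner u' (y - x) = cinner x' (v - u)"
      using adj[OF x'u'(1)] T(2) xu(1) x'u'(1)
      by (simp add: cinner.diff_right symmetric_graph_def)
    then have "cinner (u' - (- \<i>) *\<^sub>C x') (y - x) = 0"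
      unfolding vu by (simp add: cinner_add_left cinner_scaleC_left cinner_scaleC_right)
    then have "y = x" unfolding x'u'(2) by (simp add: cinner_self_eq_0)
    moreover from this have "v = u" using vu by (simp add: complex_vector.scale_zero_right)
    ultimately show "(y, v) \<in> T" using xu(1) by simp
  qed
  moreover have "T \<subseteq> adjoint_graph T"
    using T(2) by (auto simp: adjoint_graph_def symmetric_graph_def)
  ultimately show ?thesis
    using T(1) dom by (auto simp: self_adjoint_def is_operator_def linear_graph_def)
qed

text \<open>The resolvents at \<open>z + \<i> \<delta>\<close> stay bounded as \<open>\<delta> \<rightarrow> 0\<close>, so the range of \<open>T - z\<close> is dense.\<close>

lemma symmetric_real_resolvent:
  fixes T :: "('a::complex_hilbert \<times> 'a) set"
  assumes T: "linear_graph T" "closed T" "symmetric_graph T"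
    and surj: "\<And>z y. Im z \<noteq> 0 \<Longrightarrow> \<exists>(x, u)\<in>T. u - z *\<^sub>C x = y"
    and z: "Im z = 0" and c: "c > 0"
    and below: "\<And>x u. (x, u) \<in> T \<Longrightarrow> c * norm x \<le> norm (u - z *\<^sub>C x)"
  shows "z \<in> resolvent_set UNIV T"
proof -
  have "y \<in> closure ((\<lambda>(x, u). u - z *\<^sub>C x) ` T)" for y
  proof -
    define d where "d = (\<lambda>n. inverse (real (Suc n)))"
    have d: "d n > 0" for n by (simp add: d_def)
    have "\<exists>x u. (x, u) \<in> T \<and> u - (z + \<i> * d n) *\<^sub>C x = y" for n
      using surj[of "z + \<i> * d n" y] z d[of n] by auto
    then obtain f g where fg: "\<And>n. (f n, g n) \<in> T" "\<And>n. g n - (z + \<i> * d n) *\<^sub>C f n = y"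
      by metis
    have bound: "c * norm (f n) \<le> norm y" for n
    proof -
      \<comment> \<open>As \<open>cinner w (f n)\<close> is real, \<open>w\<close> and the remaining
        summand of \<open>y\<close> have a product with zero real part. Pythagoras gives
        \<open>norm w \<le> norm y\<close>, a bound independent of \<open>d n\<close>.\<close>
      define w where "w = g n - z *\<^sub>C f n"
      have "Im (cinner w (f n)) = 0"
        using symmetric_cinner_real[OF T(3) fg(1)] z
        by (simp add: w_def cinner.diff_left cinner_scaleC_left cinner_norm)
      then have "Re (cinner w ((- \<i> * d n) *\<^sub>C f n)) = 0"
        by (simp add: cinner_scaleC_right del: complex_vector.scale_minus_left)
      moreover have "y = w + (- \<i> * d n) *\<^sub>C f n"
        by (simp add: w_def fg(2)[of n, symmetric] scaleC_add_left complex_vector.scale_minus_left)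
      ultimately have "(norm w)\<^sup>2 \<le> (norm y)\<^sup>2"
        by (simp only: norm_add_sqr) simp
      then have "norm w \<le> norm y" by (simp add: power2_le_iff_abs_le)
      then show ?thesis using below[OF fg(1)[of n]] by (simp add: w_def)
    qed
    have "(\<lambda>n. g n - z *\<^sub>C f n) \<longlonglongrightarrow> y"
    proof (rule LIM_zero_cancel, rule Lim_null_comparison)
      have "g n - z *\<^sub>C f n - y = (\<i> * d n) *\<^sub>C f n" for n
        by (simp add: fg(2)[of n, symmetric] scaleC_add_left)
      moreover have "norm (f n) \<le> norm y / c" for n
        using bound[of n] c by (simp add: field_simps)
      ultimately show "\<forall>\<^sub>F n in sequentially. norm (g n - z *\<^sub>C f n - y) \<le> d n * (norm y / c)"
        using d by (intro always_eventually allI)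
          (simp add: norm_scaleC norm_mult mult_left_mono less_imp_le del: times_divide_eq_right)
      show "(\<lambda>n. d n * (norm y / c)) \<longlonglongrightarrow> 0"
        unfolding d_def using tendsto_mult_left_zero[OF LIMSEQ_inverse_real_of_nat] by blast
    qed
    moreover have "g n - z *\<^sub>C f n \<in> (\<lambda>(x, u). u - z *\<^sub>C x) ` T" for n
      using fg(1)[of n] by force
    ultimately show ?thesis
      unfolding closure_sequential by (intro exI[of _ "\<lambda>n. g n - z *\<^sub>C f n"] conjI allI)
  qed
  then show ?thesis
    by (intro mem_resolvent_set_UNIV[OF T(1) c below] surj_if_closed_dense_range[OF T(1,2) c below])
qed


section \<open>Injective linear maps of a finite-dimensional span\<close>

lemma injective_on_span_imp_surjective:
  fixes f :: "'a::complex_inner \<Rightarrow> 'a"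
  assumes B: "finite B" "\<not> complex_vector.dependent B"
    and f: "Vector_Spaces.linear scaleC scaleC f" "\<And>x. x \<in> cspan B \<Longrightarrow> f x \<in> cspan B"
    and inj: "\<And>x. x \<in> cspan B \<Longrightarrow> f x = 0 \<Longrightarrow> x = 0"
    and y: "y \<in> cspan B"
  shows "\<exists>x\<in>cspan B. f x = y"
proof -
  interpret f: Vector_Spaces.linear scaleC scaleC f by (rule f)
  have inj': "inj_on f (cspan B)"
    using inj by (intro inj_onI) (metis complex_vector.span_diff eq_iff_diff_eq_0 f.diff)
  have ind: "\<not> complex_vector.dependent (f ` B)"
    using f.independent_injective_image[OF B(2) inj'] .
  have card: "card (f ` B) = card B"
    by (rule card_image) (rule inj_on_subset[OF inj' complex_vector.span_superset])
  have sub: "f ` B \<subseteq> cspan B"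
    using f(2) complex_vector.span_superset by blast
  have "y \<in> cspan (f ` B)"
  proof (rule ccontr)
    assume ny: "y \<notin> cspan (f ` B)"
    then have "\<not> complex_vector.dependent (insert y (f ` B))"
      by (simp add: ind complex_vector.independent_insert)
    then have "card (insert y (f ` B)) \<le> card B"
      using sub y by (intro conjunct2[OF complex_vector.independent_span_bound] B) auto
    moreover have "y \<notin> f ` B" using ny complex_vector.span_base[of y "f ` B"] by metis
    then have "card (insert y (f ` B)) = Suc (card B)"
      unfolding card[symmetric] by (rule card_insert_disjoint[OF finite_imageI[OF B(1)]])
    ultimately show False by linarith
  qed
  then have "y \<in> f ` cspan B" by (simp only: f.span_image)
  then show ?thesis by (auto simp only: image_iff)
qed

subsection \<open>Finite sections of a tridiagonal operator\<close>

locale jacobi =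
  fixes e :: "nat \<Rightarrow> 'a::complex_hilbert" and a b :: "nat \<Rightarrow> real"
  assumes basis: "orthonormal_basis e" and a_pos: "\<And>n. n \<ge> 1 \<Longrightarrow> a n > 0"
begin

abbreviation "H \<equiv> trunc_space e"
abbreviation "S \<equiv> tridiag_span a b e"
abbreviation "T \<equiv> tridiag a b e"
abbreviation "t \<equiv> tridiag_basis a b e"

text \<open>An explicit form of \<open>orth_proj (H N)\<close>, for which linearity is immediate;
  \<open>orth_proj_H\<close> identifies the two.\<close>

definition P :: "nat \<Rightarrow> 'a \<Rightarrow> 'a"
  where "P N x = (\<Sum>n=1..N. cinner x (e n) *\<^sub>C e n)"

text \<open>This is \<open>T P\<^sub>N\<close> as a total linear map, usable before \<open>T\<close>
  is known to be single valued.\<close>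

definition J :: "nat \<Rightarrow> 'a \<Rightarrow> 'a"
  where "J N x = (\<Sum>n=1..N. cinner x (e n) *\<^sub>C t n)"

text \<open>This is \<open>P\<^sub>N T P\<^sub>N\<close>, extended to a linear map of the whole
  space.\<close>

definition A :: "nat \<Rightarrow> 'a \<Rightarrow> 'a"
  where "A N x = P N (J N x)"

lemma cinner_basis: "m \<ge> 1 \<Longrightarrow> n \<ge> 1 \<Longrightarrow> cinner (e m) (e n) = (if m = n then 1 else 0)"
  using basis by (simp add: orthonormal_basis_def)

lemma norm_basis: "n \<ge> 1 \<Longrightarrow> norm (e n) = 1"
  using Re_cinner_self[of "e n"] by (simp add: cinner_basis abs_square_eq_1 eq_commute[of 1])

lemma linear_P: "Vector_Spaces.linear scaleC scaleC (P N)"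
  by unfold_locales (simp_all add: P_def cinner_add_left cinner_scaleC_left scaleC_add_left
      sum.distrib scaleC.sum_right scaleC_scaleC)

lemma linear_J: "Vector_Spaces.linear scaleC scaleC (J N)"
  by unfold_locales (simp_all add: J_def cinner_add_left cinner_scaleC_left scaleC_add_left
      sum.distrib scaleC.sum_right scaleC_scaleC)

lemma linear_A: "Vector_Spaces.linear scaleC scaleC (A N)"
proof -
  interpret p: Vector_Spaces.linear scaleC scaleC "P N" by (rule linear_P)
  interpret j: Vector_Spaces.linear scaleC scaleC "J N" by (rule linear_J)
  show ?thesis
    by unfold_locales (simp_all add: A_def p.add p.scale j.add j.scale)
qed

lemma H_add: "x \<in> H N \<Longrightarrow> y \<in> H N \<Longrightarrow> x + y \<in> H N"
  and H_scale: "x \<in> H N \<Longrightarrow> c *\<^sub>C x \<in> H N"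
  and H_diff: "x \<in> H N \<Longrightarrow> y \<in> H N \<Longrightarrow> x - y \<in> H N"
  and H_0: "0 \<in> H N"
  by (simp_all add: trunc_space_def complex_vector.span_add complex_vector.span_scale
      complex_vector.span_diff complex_vector.span_zero)

lemma H_basis: "1 \<le> n \<Longrightarrow> n \<le> N \<Longrightarrow> e n \<in> H N"
  unfolding trunc_space_def by (rule complex_vector.span_base) simp

lemma H_mono: "N \<le> M \<Longrightarrow> H N \<subseteq> H M"
  unfolding trunc_space_def by (intro complex_vector.span_mono image_mono) auto

lemma H_sum: "(\<Sum>n=1..N. c n *\<^sub>C e n) \<in> H N"
  unfolding trunc_space_def
  by (intro complex_vector.span_sum complex_vector.span_scale complex_vector.span_base) auto

lemma P_in_H: "P N x \<in> H N"
  unfolding P_def by (rule H_sum)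

lemma A_in_H: "A N x \<in> H N"
  unfolding A_def by (rule P_in_H)

lemma cinner_P:
  assumes "n \<ge> 1"
  shows "cinner (P N x) (e n) = (if n \<le> N then cinner x (e n) else 0)"
proof -
  have "cinner (P N x) (e n) = (\<Sum>m=1..N. if m = n then cinner x (e n) else 0)"
    unfolding P_def cinner.sum_left using assms
    by (intro sum.cong) (auto simp: cinner_scaleC_left cinner_basis)
  then show ?thesis using assms by simp
qed

lemma P_id: "x \<in> H N \<Longrightarrow> P N x = x"
  unfolding trunc_space_def
proof (induction rule: complex_vector.span_induct)
  case base
  interpret p: Vector_Spaces.linear scaleC scaleC "P N" by (rule linear_P)
  show ?case
    unfolding complex_vector.subspace_def by (auto simp: p.add p.scale)
next
  case (step x)
  then obtain n where n: "1 \<le> n" "n \<le> N" "x = e n" by auto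
  have "P N (e n) = (\<Sum>m=1..N. if m = n then e n else 0)"
    unfolding P_def using n
    by (intro sum.cong) (auto simp: cinner_basis scaleC_one)
  then show ?case using n by simp
qed

lemma cinner_H_above: "x \<in> H N \<Longrightarrow> N < n \<Longrightarrow> cinner x (e n) = 0"
  using cinner_P[of n N x] P_id[of x N] by simp

lemma cinner_H_right:
  assumes "y \<in> H N"
  shows "cinner x y = (\<Sum>n=1..N. cnj (cinner y (e n)) * cinner x (e n))"
proof -
  have "cinner x y = cinner x (P N y)" using P_id[OF assms] by simp
  then show ?thesis
    by (simp add: P_def cinner.sum_right cinner_scaleC_right)
qed

lemma cinner_H_left:
  assumes "x \<in> H N"
  shows "cinner x y = (\<Sum>n=1..N. cinner x (e n) * cinner (e n) y)"
proof -
  have "cinner x y = cinner (P N x) y" using P_id[OF assms] by simp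
  then show ?thesis
    by (simp add: P_def cinner.sum_left cinner_scaleC_left)
qed

lemma cinner_P_H: "y \<in> H N \<Longrightarrow> cinner (P N x) y = cinner x y"
  by (simp add: cinner_H_right[of y N] cinner_P)

lemma orth_proj_H: "orth_proj (H N) x = P N x"
  unfolding orth_proj_def
proof (rule the_equality)
  show "P N x \<in> H N \<and> (\<forall>z\<in>H N. cinner (x - P N x) z = 0)"
    by (simp add: P_in_H cinner.diff_left cinner_P_H)
next
  fix y assume y: "y \<in> H N \<and> (\<forall>z\<in>H N. cinner (x - y) z = 0)"
  then have "cinner (P N x - y) (P N x - y) = cinner (x - y) (P N x - y)"
    using H_diff[OF P_in_H[of N x], of y] by (simp add: cinner.diff_left cinner_P_H)
  also have "\<dots> = 0" using y H_diff[OF P_in_H[of N x], of y] by blast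
  finally show "y = P N x" by (simp add: cinner_self_eq_0)
qed

section \<open>The operator on the span of the basis: symmetry and matrix entries\<close>

lemma J_mono: "x \<in> H N \<Longrightarrow> N \<le> M \<Longrightarrow> J M x = J N x"
  unfolding J_def by (rule sum.mono_neutral_right) (auto simp: cinner_H_above)

text \<open>Orthonormality recovers the coefficients of a finite combination from the vector, so
  \<open>S\<close> is the union of the graphs of \<open>J N\<close> over \<open>H N\<close>.\<close>

lemma mem_S_iff: "(x, u) \<in> S \<longleftrightarrow> (\<exists>N. x \<in> H N \<and> u = J N x)"
proof
  assume "(x, u) \<in> S"
  then obtain c N where x: "x = (\<Sum>n=1..N. c n *\<^sub>C e n)" and u: "u = (\<Sum>n=1..N. c n *\<^sub>C t n)"
    unfolding tridiag_span_def by auto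
  have "cinner x (e m) = c m" if "m \<in> {1..N}" for m
  proof -
    have "cinner x (e m) = (\<Sum>n=1..N. if n = m then c m else 0)"
      unfolding x cinner.sum_left using that
      by (intro sum.cong) (auto simp: cinner_scaleC_left cinner_basis)
    then show ?thesis using that by simp
  qed
  then have "u = J N x" unfolding u J_def by simp
  then show "\<exists>N. x \<in> H N \<and> u = J N x" using x H_sum by blast
next
  assume "\<exists>N. x \<in> H N \<and> u = J N x"
  then obtain N where N: "x \<in> H N" "u = J N x" by blast
  then have "x = (\<Sum>n=1..N. cinner x (e n) *\<^sub>C e n)"
    using P_id unfolding P_def by simp
  then show "(x, u) \<in> S"
    using N(2) unfolding tridiag_span_def J_def
    by (intro CollectI exI[of _ "\<lambda>n. cinner x (e n)"] exI[of _ N]) simp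
qed

lemma linear_graph_S: "linear_graph S"
  unfolding linear_graph_def
proof (intro conjI allI impI)
  show "(0, 0) \<in> S"
    unfolding mem_S_iff by (intro exI[of _ 0]) (simp add: H_0 J_def)
next
  fix x u y v assume "(x, u) \<in> S" "(y, v) \<in> S"
  then obtain N M where N: "x \<in> H N" "u = J N x" and M: "y \<in> H M" "v = J M y"
    unfolding mem_S_iff by blast
  define L where "L = max N M"
  interpret j: Vector_Spaces.linear scaleC scaleC "J L" by (rule linear_J)
  have "x \<in> H L" "y \<in> H L" "u = J L x" "v = J L y"
    using N M H_mono[of N L] H_mono[of M L] J_mono[of x N L] J_mono[of y M L]
    by (auto simp: L_def)
  then show "(x + y, u + v) \<in> S"
    unfolding mem_S_iff by (auto simp: H_add j.add intro!: exI[of _ L])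
next
  fix c x u assume "(x, u) \<in> S"
  then obtain N where N: "x \<in> H N" "u = J N x"
    unfolding mem_S_iff by blast
  interpret j: Vector_Spaces.linear scaleC scaleC "J N" by (rule linear_J)
  show "(c *\<^sub>C x, c *\<^sub>C u) \<in> S"
    unfolding mem_S_iff using N by (auto simp: H_scale j.scale intro!: exI[of _ N])
qed

text \<open>For \<open>m = 1\<close> the third case would ask for \<open>n = 0\<close>, which
  \<open>n \<ge> 1\<close> excludes; \<open>a 0\<close> is never read.\<close>

lemma cinner_tridiag_basis:
  assumes "m \<ge> 1" "n \<ge> 1"
  shows "cinner (t m) (e n) = (if n = m + 1 then a m else if n = m then b m
    else if n = m - 1 then a (m - 1) else 0)"
  using assms by (auto simp: tridiag_basis_def cinner_add_left cinner.scaleR_left cinner_basis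
      scaleR_conv_of_real)

lemma cinner_tridiag_basis_sym:
  assumes "m \<ge> 1" "n \<ge> 1"
  shows "cinner (t m) (e n) = cinner (e m) (t n)"
proof -
  have "cinner (e m) (t n) = cnj (cinner (t n) (e m))" by (rule cinner_commute)
  then show ?thesis using assms by (auto simp: cinner_tridiag_basis)
qed

lemma symmetric_graph_S: "symmetric_graph S"
  unfolding symmetric_graph_def
proof (intro allI impI)
  fix x u y v assume "(x, u) \<in> S" "(y, v) \<in> S"
  then obtain N M where N: "x \<in> H N" "u = J N x" and M: "y \<in> H M" "v = J M y"
    unfolding mem_S_iff by blast
  have "cinner u y = (\<Sum>m=1..M. \<Sum>n=1..N.
      cnj (cinner y (e m)) * cinner x (e n) * cinner (t n) (e m))"
    by (simp add: cinner_H_right[OF M(1)] N(2) J_def cinner.sum_left cinner_scaleC_left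
        sum_distrib_left mult.assoc)
  also have "\<dots> = (\<Sum>n=1..N. \<Sum>m=1..M.
      cnj (cinner y (e m)) * cinner x (e n) * cinner (t n) (e m))"
    by (rule sum.swap)
  also have "\<dots> = (\<Sum>n=1..N. \<Sum>m=1..M.
      cnj (cinner y (e m)) * cinner x (e n) * cinner (e n) (t m))"
    by (intro sum.cong refl) (simp add: cinner_tridiag_basis_sym)
  also have "\<dots> = cinner x v"
    unfolding cinner_H_left[OF N(1), of v]
    by (simp add: M(2) J_def cinner.sum_right cinner_scaleC_right sum_distrib_left mult_ac)
  finally show "cinner u y = cinner x v" .
qed

lemma linear_graph_T: "linear_graph T"
  unfolding tridiag_def by (rule linear_graph_closure[OF linear_graph_S])

lemma symmetric_graph_T: "symmetric_graph T"
  unfolding tridiag_def by (rule symmetric_graph_closure[OF symmetric_graph_S])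

lemma closed_T: "closed T"
  by (simp add: tridiag_def)

lemma S_subset_T: "S \<subseteq> T"
  unfolding tridiag_def by (rule closure_subset)

lemma J_in_S: "x \<in> H N \<Longrightarrow> (x, J N x) \<in> S"
  unfolding mem_S_iff by blast

lemma J_in_T: "x \<in> H N \<Longrightarrow> (x, J N x) \<in> T"
  using J_in_S S_subset_T by blast

lemma J_basis: "n \<ge> 1 \<Longrightarrow> J n (e n) = t n"
proof -
  assume n: "n \<ge> 1"
  have "J n (e n) = (\<Sum>m=1..n. if m = n then t n else 0)"
    unfolding J_def using n by (intro sum.cong) (auto simp: cinner_basis scaleC_one)
  then show ?thesis using n by simp
qed

text \<open>Symmetry moves the operator onto \<open>e n\<close> and reads off row \<open>n\<close>
  of the matrix. The index \<open>n\<close> may exceed \<open>N\<close>; row \<open>N + 1\<close>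
  matters for \<open>J_eq_A\<close>.\<close>

lemma cinner_J:
  assumes x: "x \<in> H N" and n: "n \<ge> 1"
  shows "cinner (J N x) (e n) = a n * cinner x (e (n + 1)) + b n * cinner x (e n) +
    (if n = 1 then 0 else a (n - 1) * cinner x (e (n - 1)))"
proof -
  have "(e n, t n) \<in> S" using J_in_S[OF H_basis[OF n order_refl]] J_basis[OF n] by simp
  then have "cinner (J N x) (e n) = cinner x (t n)"
    using symmetric_graph_S J_in_S[OF x] unfolding symmetric_graph_def by blast
  then show ?thesis
    by (simp add: tridiag_basis_def cinner_add_right cinner.scaleR_right scaleR_conv_of_real)
qed

lemma H_eqI:
  assumes "x \<in> H N" "y \<in> H N" "\<And>n. 1 \<le> n \<Longrightarrow> n \<le> N \<Longrightarrow> cinner x (e n) = cinner y (e n)"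
  shows "x = y"
proof -
  have "P N x = P N y" unfolding P_def using assms(3) by simp
  then show ?thesis using assms(1,2) P_id by metis
qed

lemma tridiag_basis_in_H: "n \<ge> 1 \<Longrightarrow> n \<le> N \<Longrightarrow> t n \<in> H (N + 1)"
  unfolding tridiag_basis_def scaleR_scaleC
  by (intro H_add H_scale) (auto intro!: H_add H_scale H_basis simp: H_0)

lemma J_in_H: "J N x \<in> H (N + 1)"
  unfolding J_def trunc_space_def
  by (intro complex_vector.span_sum complex_vector.span_scale)
    (use tridiag_basis_in_H in \<open>auto simp: trunc_space_def\<close>)

text \<open>Compare coordinates: \<open>P N\<close> keeps rows up to \<open>N\<close>, and in row
  \<open>N + 1\<close> only the term with \<open>a N\<close> survives, because \<open>x\<close> has
  no coordinates above \<open>N\<close>.\<close>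

lemma J_eq_A:
  assumes "x \<in> H N" "N \<ge> 1"
  shows "J N x = A N x + (a N * cinner x (e N)) *\<^sub>C e (N + 1)"
proof (rule H_eqI[OF J_in_H])
  show "A N x + (a N * cinner x (e N)) *\<^sub>C e (N + 1) \<in> H (N + 1)"
    using A_in_H[of N x] H_mono[of N "N + 1"] by (intro H_add H_scale H_basis) auto
next
  fix n assume n: "1 \<le> n" "n \<le> N + 1"
  show "cinner (J N x) (e n) = cinner (A N x + (a N * cinner x (e N)) *\<^sub>C e (N + 1)) (e n)"
    using n assms
    by (cases "n \<le> N")
      (auto simp: A_def cinner_add_left cinner_P cinner_scaleC_left cinner_basis cinner_J
        cinner_H_above not_le le_Suc_eq)
qed

lemma A_symmetric: "x \<in> H N \<Longrightarrow> y \<in> H N \<Longrightarrow> cinner (A N x) y = cinner x (A N y)"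
proof -
  assume xy: "x \<in> H N" "y \<in> H N"
  have "cinner (A N x) y = cinner (J N x) y" using xy by (simp add: A_def cinner_P_H)
  also have "\<dots> = cinner x (J N y)"
    using symmetric_graph_S J_in_S xy unfolding symmetric_graph_def by blast
  also have "\<dots> = cnj (cinner (J N y) x)" by (rule cinner_commute)
  also have "\<dots> = cnj (cinner (A N y) x)" using xy by (simp add: A_def cinner_P_H)
  also have "\<dots> = cinner x (A N y)" by (rule cinner_commute[symmetric])
  finally show ?thesis .
qed


section \<open>Linear algebra on the finite-dimensional spaces \<open>H N\<close>\<close>

lemma basis_independent: "\<not> complex_vector.dependent (e ` {1..N})"
proof (rule complex_vector.independent_if_scalars_zero)
  have inj: "inj_on e {1..N}"
  proof (rule inj_onI)
    fix m n assume "m \<in> {1..N}" "n \<in> {1..N}" "e m = e n"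
    then show "m = n" using cinner_basis[of m n] cinner_basis[of n n] by (auto split: if_splits)
  qed
  fix f x assume 0: "(\<Sum>x\<in>e ` {1..N}. f x *\<^sub>C x) = 0" and "x \<in> e ` {1..N}"
  then obtain m where m: "m \<in> {1..N}" "x = e m" by auto
  have "0 = cinner (\<Sum>n=1..N. f (e n) *\<^sub>C e n) (e m)"
    using 0 by (simp only: sum.reindex[OF inj] comp_def cinner_zero_left)
  also have "\<dots> = (\<Sum>n=1..N. if n = m then f x else 0)"
    unfolding cinner.sum_left using m
    by (intro sum.cong) (auto simp: cinner_scaleC_left cinner_basis)
  finally show "f x = 0" using m by simp
qed simp

lemma norm_cinner_basis_le: "n \<ge> 1 \<Longrightarrow> norm (cinner x (e n)) \<le> norm x"
  using cinner_Cauchy_Schwarz[of x "e n"] by (simp add: norm_basis)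

text \<open>The \<open>+ 1\<close> makes the constant strictly positive even if the sum vanishes, as
  the bounds \<open>K > 0\<close> derived from it require.\<close>

lemma norm_sum_scaleC_le:
  assumes "\<And>n. 1 \<le> n \<Longrightarrow> n \<le> N \<Longrightarrow> norm (c n) \<le> C" and C: "C \<ge> 0"
  shows "norm (\<Sum>n=1..N. c n *\<^sub>C (g n :: 'a)) \<le> ((\<Sum>n=1..N. norm (g n)) + 1) * C"
proof -
  have "norm (\<Sum>n=1..N. c n *\<^sub>C g n) \<le> (\<Sum>n=1..N. norm (g n) * C)"
    using assms by (intro sum_norm_le)
      (auto simp: norm_scaleC mult.commute[of _ C] intro!: mult_right_mono)
  also have "\<dots> \<le> ((\<Sum>n=1..N. norm (g n)) + 1) * C"
    using C by (simp add: sum_distrib_right[symmetric] mult_right_mono)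
  finally show ?thesis .
qed

lemma linear_bounded_on_H:
  assumes f: "Vector_Spaces.linear scaleC scaleC (f :: 'a \<Rightarrow> 'a)"
  shows "\<exists>K>0. \<forall>x\<in>H N. norm (f x) \<le> K * norm x"
proof -
  interpret f: Vector_Spaces.linear scaleC scaleC f by (rule f)
  have "norm (f x) \<le> ((\<Sum>n=1..N. norm (f (e n))) + 1) * norm x" if "x \<in> H N" for x
  proof -
    have "f x = f (P N x)" using P_id[OF that] by simp
    also have "\<dots> = (\<Sum>n=1..N. cinner x (e n) *\<^sub>C f (e n))"
      unfolding P_def by (simp add: f.sum f.scale)
    finally show ?thesis
      using norm_sum_scaleC_le[of N "\<lambda>n. cinner x (e n)" "norm x" "\<lambda>n. f (e n)"]
        norm_cinner_basis_le by simp
  qed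
  moreover have "(\<Sum>n=1..N. norm (f (e n))) + 1 > 0"
    by (intro add_nonneg_pos sum_nonneg) auto
  ultimately show ?thesis by blast
qed

lemma injective_on_H:
  assumes f: "Vector_Spaces.linear scaleC scaleC f" "\<And>x. x \<in> H N \<Longrightarrow> f x \<in> H N"
    and inj: "\<And>x. x \<in> H N \<Longrightarrow> f x = 0 \<Longrightarrow> x = 0"
  shows "\<And>y. y \<in> H N \<Longrightarrow> \<exists>x\<in>H N. f x = y"
    and "\<exists>K>0. \<forall>x\<in>H N. norm x \<le> K * norm (f x)"
proof -
  interpret f: Vector_Spaces.linear scaleC scaleC f by (rule f)
  show surj: "\<exists>x\<in>H N. f x = y" if "y \<in> H N" for y
    using injective_on_span_imp_surjective[OF _ basis_independent f(1)] f(2) inj that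
    unfolding trunc_space_def by blast
  then have "\<forall>n. \<exists>x. n \<in> {1..N} \<longrightarrow> x \<in> H N \<and> f x = e n"
    using H_basis by (metis atLeastAtMost_iff)
  then obtain g where g: "\<And>n. n \<in> {1..N} \<Longrightarrow> g n \<in> H N \<and> f (g n) = e n" by metis
  have "norm x \<le> ((\<Sum>n=1..N. norm (g n)) + 1) * norm (f x)" if x: "x \<in> H N" for x
  proof -
    \<comment> \<open>By linearity \<open>f y = f x\<close>, so injectivity gives
      \<open>x = y\<close>; the bound then depends only on the fixed preimages \<open>g n\<close> of
      the basis vectors.\<close>
    define y where "y = (\<Sum>n=1..N. cinner (f x) (e n) *\<^sub>C g n)"
    have y: "y \<in> H N"
      unfolding y_def using g unfolding trunc_space_def
      by (intro complex_vector.span_sum complex_vector.span_scale) auto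
    have "f y = P N (f x)"
      unfolding y_def P_def using g by (simp add: f.sum f.scale)
    then have "f (x - y) = 0" using P_id[OF f(2)[OF x]] by (simp add: f.diff)
    then have "x = y" using inj[OF H_diff[OF x y]] by simp
    then show ?thesis
      using norm_sum_scaleC_le[of N "\<lambda>n. cinner (f x) (e n)" "norm (f x)" g] norm_cinner_basis_le
      by (simp add: y_def)
  qed
  moreover have "(\<Sum>n=1..N. norm (g n)) + 1 > 0"
    by (intro add_nonneg_pos sum_nonneg) auto
  ultimately show "\<exists>K>0. \<forall>x\<in>H N. norm x \<le> K * norm (f x)" by blast
qed

section \<open>Eigenvalues of the finite sections and decay of truncated solutions\<close>

lemma linear_shift:
  assumes "Vector_Spaces.linear scaleC scaleC (f :: 'a \<Rightarrow> 'a)"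
  shows "Vector_Spaces.linear scaleC scaleC (\<lambda>x. f x - z *\<^sub>C x)"
proof -
  interpret f: Vector_Spaces.linear scaleC scaleC f by (rule assms)
  show ?thesis
    by unfold_locales (simp_all add: f.add f.scale scaleC_add_right scaleC.diff_right
        scaleC_scaleC mult.commute)
qed

text \<open>Let \<open>m\<close> be the minimum of \<open>\<parallel>B x\<parallel>\<close> over unit vectors, \<open>B = A N - r\<close>. The form of
  \<open>C = B\<^sup>2 - m\<^sup>2\<close> is positive semidefinite and not bounded below, so \<open>C\<close> has a kernel, and
  \<open>C = (B + m) (B - m)\<close> gives an eigenvalue of \<open>A N\<close> at distance \<open>m\<close> from \<open>r\<close>.\<close>

lemma nearest_eigenvalue:
  assumes N: "N \<ge> 1"
  shows "\<exists>l x. x \<in> H N \<and> x \<noteq> 0 \<and> A N x = l *\<^sub>C x \<and>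
    (\<forall>y\<in>H N. norm (l - complex_of_real r) * norm y \<le> norm (A N y - complex_of_real r *\<^sub>C y))"
proof -
  define B where "B = (\<lambda>x. A N x - complex_of_real r *\<^sub>C x)"
  have linB: "Vector_Spaces.linear scaleC scaleC B"
    unfolding B_def by (rule linear_shift[OF linear_A])
  interpret B: Vector_Spaces.linear scaleC scaleC B by (rule linB)
  have B_H: "B x \<in> H N" if "x \<in> H N" for x
    unfolding B_def by (intro H_diff A_in_H H_scale that)
  have B_sym: "cinner (B x) y = cinner x (B y)" if "x \<in> H N" "y \<in> H N" for x y
    unfolding B_def using A_symmetric[OF that]
    by (simp add: cinner.diff_left cinner.diff_right cinner_scaleC_left cinner_scaleC_right)
  define U where "U = {x \<in> H N. norm x = 1}"
  have U_ne: "U \<noteq> {}" using H_basis[OF order_refl N] norm_basis[of 1] unfolding U_def by auto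
  \<comment> \<open>The infimum is not yet known to be attained; the kernel vector of
    \<open>C\<close> found below supplies this without a compactness argument.\<close>
  define m2 where "m2 = (INF x\<in>U. (norm (B x))\<^sup>2)"
  have m2_le: "m2 \<le> (norm (B x))\<^sup>2" if "x \<in> U" for x
    unfolding m2_def by (rule cINF_lower[OF _ that]) (auto intro: bdd_belowI[of _ 0])
  have m2_nonneg: "m2 \<ge> 0"
    unfolding m2_def by (rule cINF_greatest[OF U_ne]) simp
  define m where "m = sqrt m2"
  have m: "m \<ge> 0" "m\<^sup>2 = m2" using m2_nonneg by (simp_all add: m_def)
  have m_le: "m * norm x \<le> norm (B x)" if x: "x \<in> H N" for x
  proof (cases "x = 0")
    case False
    define y where "y = complex_of_real (inverse (norm x)) *\<^sub>C x"
    have "y \<in> U" using False x by (simp add: U_def y_def H_scale norm_scaleC norm_inverse)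
    then have "m\<^sup>2 \<le> (norm (B y))\<^sup>2" using m2_le m(2) by simp
    then have "m \<le> norm (B y)" by (rule power2_le_imp_le) simp
    also have "norm (B y) = norm (B x) / norm x"
      by (simp add: y_def B.scale norm_scaleC norm_inverse divide_inverse)
    finally show ?thesis using False by (simp add: field_simps)
  qed (simp add: m)
  define C where "C = (\<lambda>x. B (B x) - complex_of_real m2 *\<^sub>C x)"
  have linC: "Vector_Spaces.linear scaleC scaleC C"
    unfolding C_def
    by (rule linear_shift) (unfold_locales, simp_all add: B.add B.scale)
  interpret C: Vector_Spaces.linear scaleC scaleC C by (rule linC)
  have C_H: "C x \<in> H N" if "x \<in> H N" for x
    unfolding C_def by (intro H_diff B_H H_scale that)
  have C_sym: "cinner (C x) y = cinner x (C y)" if "x \<in> H N" "y \<in> H N" for x y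
    unfolding C_def using B_sym B_H that
    by (simp add: cinner.diff_left cinner.diff_right cinner_scaleC_left cinner_scaleC_right)
  have q: "Re (cinner (C x) x) = (norm (B x))\<^sup>2 - m2 * (norm x)\<^sup>2" if "x \<in> H N" for x
    unfolding C_def using B_sym[OF B_H[OF that] that]
    by (simp add: cinner.diff_left cinner_scaleC_left cinner_norm)
  have q_nonneg: "Re (cinner (C x) x) \<ge> 0" if "x \<in> H N" for x
  proof -
    have "(m * norm x)\<^sup>2 \<le> (norm (B x))\<^sup>2"
      using m_le[OF that] m(1) by (intro power_mono) auto
    then show ?thesis using q[OF that] m(2) by (simp add: power_mult_distrib)
  qed
  obtain K where K: "K > 0" "\<And>x. x \<in> H N \<Longrightarrow> norm (C x) \<le> K * norm x"
    using linear_bounded_on_H[OF linC] by blast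
  \<comment> \<open>Positivity of the form at \<open>x - s *\<^sub>C C x\<close>, one gradient step
    of size \<open>1 / K\<close>, shows that a small value of the form at \<open>x\<close> forces
    \<open>C x\<close> to be small.\<close>
  have C_le_q: "(norm (C x))\<^sup>2 / K \<le> Re (cinner (C x) x)" if x: "x \<in> H N" for x
  proof -
    define s where "s = complex_of_real (1 / K)"
    have "0 \<le> Re (cinner (C (x - s *\<^sub>C C x)) (x - s *\<^sub>C C x))"
      by (intro q_nonneg H_diff H_scale C_H x)
    also have "\<dots> = Re (cinner (C x) x) - 2 / K * (norm (C x))\<^sup>2
        + (1 / K)\<^sup>2 * Re (cinner (C (C x)) (C x))"
      using C_sym[OF C_H[OF x] x] K(1)
      by (simp add: s_def C.diff C.scale cinner.diff_left cinner.diff_right cinner_scaleC_left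
          cinner_scaleC_right cinner_norm power2_eq_square) (simp add: field_simps)
    also have "\<dots> \<le> Re (cinner (C x) x) - 2 / K * (norm (C x))\<^sup>2
        + (1 / K)\<^sup>2 * (K * (norm (C x))\<^sup>2)"
    proof -
      have "Re (cinner (C (C x)) (C x)) \<le> norm (C (C x)) * norm (C x)"
        by (rule order_trans[OF complex_Re_le_cmod cinner_Cauchy_Schwarz])
      also have "\<dots> \<le> K * norm (C x) * norm (C x)"
        by (intro mult_right_mono K C_H x norm_ge_zero)
      finally show ?thesis
        by (intro add_left_mono mult_left_mono) (simp_all add: power2_eq_square)
    qed
    also have "\<dots> = Re (cinner (C x) x) - (norm (C x))\<^sup>2 / K"
      using K(1) by (simp add: field_simps power2_eq_square)
    finally show ?thesis by simp
  qed
  have "\<exists>x\<in>H N. x \<noteq> 0 \<and> C x = 0"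
  proof (rule ccontr)
    assume "\<not> (\<exists>x\<in>H N. x \<noteq> 0 \<and> C x = 0)"
    then have inj: "x = 0" if "x \<in> H N" "C x = 0" for x using that by blast
    obtain L where L: "L > 0" "\<And>x. x \<in> H N \<Longrightarrow> norm x \<le> L * norm (C x)"
      using injective_on_H(2)[OF linC C_H inj] by blast
    \<comment> \<open>If \<open>C\<close> were injective, \<open>norm (C x)\<close> would be at
      least \<open>1 / L\<close> on the unit sphere. By \<open>C_le_q\<close> the form would be at
      least \<open>d\<close> there, so \<open>m2\<close> could not be the infimum.\<close>
    define d where "d = (1 / L)\<^sup>2 / K"
    have "m2 + d \<le> (INF x\<in>U. (norm (B x))\<^sup>2)"
    proof (rule cINF_greatest[OF U_ne])
      fix x assume "x \<in> U"
      then have x: "x \<in> H N" "norm x = 1" by (auto simp: U_def)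
      have "1 / L \<le> norm (C x)" using L(2)[OF x(1)] L(1) x(2) by (simp add: field_simps)
      then have "(1 / L)\<^sup>2 \<le> (norm (C x))\<^sup>2" using L(1) by (intro power_mono) auto
      then have "d \<le> (norm (C x))\<^sup>2 / K" unfolding d_def using K(1) by (intro divide_right_mono) auto
      then show "m2 + d \<le> (norm (B x))\<^sup>2" using C_le_q[OF x(1)] q[OF x(1)] x(2) by simp
    qed
    moreover have "d > 0" using L(1) K(1) by (simp add: d_def)
    ultimately show False unfolding m2_def[symmetric] by simp
  qed
  then obtain y where y: "y \<in> H N" "y \<noteq> 0" "C y = 0" by blast
  have BB: "B (B y) = complex_of_real m2 *\<^sub>C y" using y(3) by (simp add: C_def)
  have "\<exists>s x. x \<in> H N \<and> x \<noteq> 0 \<and> B x = complex_of_real s *\<^sub>C x \<and> \<bar>s\<bar> = m"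
  \<comment> \<open>Since \<open>(B + m) (B - m) y = 0\<close>, either \<open>y\<close> is an
    eigenvector for \<open>m\<close>, or \<open>(B - m) y\<close> is a nonzero one for
    \<open>- m\<close>.\<close>
  proof (cases "B y = complex_of_real m *\<^sub>C y")
    case True
    then show ?thesis using y m(1) by (intro exI[of _ m] exI[of _ y]) auto
  next
    case False
    define w where "w = B y - complex_of_real m *\<^sub>C y"
    have "B w = complex_of_real (- m) *\<^sub>C w"
      by (simp add: w_def B.diff B.scale BB m(2)[symmetric] scaleC.diff_right scaleC_scaleC
          power2_eq_square complex_vector.scale_minus_left)
    moreover have "w \<noteq> 0" "w \<in> H N"
      using False B_H[OF y(1)] y(1) by (auto simp: w_def intro!: H_diff H_scale)
    ultimately show ?thesis using m(1) by (intro exI[of _ "- m"] exI[of _ w]) auto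
  qed
  then obtain s x where sx: "x \<in> H N" "x \<noteq> 0" "B x = complex_of_real s *\<^sub>C x" "\<bar>s\<bar> = m" by blast
  have "A N x = complex_of_real (r + s) *\<^sub>C x"
    using sx(3) by (simp add: B_def scaleC_add_left algebra_simps)
  then show ?thesis
    using sx m_le by (intro exI[of _ "complex_of_real (r + s)"] exI[of _ x]) (auto simp: B_def)
qed

text \<open>Since the diagonal dominates, the solution of the truncated recurrence with \<open>x\<^sub>N\<^sub>+\<^sub>1 = 0\<close> decays
  geometrically. As \<open>J N x - A N x = a\<^sub>N x\<^sub>N e\<^sub>N\<^sub>+\<^sub>1\<close>, this controls the truncation error.\<close>

lemma truncation_tail:
  fixes z :: complex
  assumes x: "x \<in> H N" and n0: "1 \<le> n0" "n0 \<le> N"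
    and dom: "\<And>n. n0 < n \<Longrightarrow> n \<le> N \<Longrightarrow>
      4 * a n \<le> norm (b n - z) \<and> 4 * a (n - 1) \<le> norm (b n - z)"
    and eq: "\<And>n. n0 < n \<Longrightarrow> n \<le> N \<Longrightarrow> cinner (A N x) (e n) = z * cinner x (e n)"
  shows "a N * norm (cinner x (e N)) \<le> (1 / 3) ^ (N - n0) * (a n0 * norm x)"
proof -
  define X where "X = (\<lambda>n. norm (cinner x (e n)))"
  have X0: "X n \<ge> 0" for n by (simp add: X_def)
  have step: "norm (b n - z) * X n \<le> a n * X (n + 1) + a (n - 1) * X (n - 1)"
    if n: "n0 < n" "n \<le> N" for n
  proof -
    have "z * cinner x (e n) = a n * cinner x (e (n + 1)) + b n * cinner x (e n) +
        a (n - 1) * cinner x (e (n - 1))"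
      using eq[OF n] cinner_J[OF x, of n] n n0 by (simp add: A_def cinner_P)
    then have "(b n - z) * cinner x (e n) =
        - (a n * cinner x (e (n + 1)) + a (n - 1) * cinner x (e (n - 1)))"
      by (simp add: algebra_simps)
    then have "norm (b n - z) * X n =
        norm (a n * cinner x (e (n + 1)) + a (n - 1) * cinner x (e (n - 1)))"
      unfolding X_def by (metis norm_minus_cancel norm_mult)
    also have "\<dots> \<le> a n * X (n + 1) + a (n - 1) * X (n - 1)"
    proof -
      have "a n > 0" "a (n - 1) > 0" using n n0 by (auto intro!: a_pos)
      then show ?thesis
        by (intro order_trans[OF norm_triangle_ineq]) (simp add: norm_mult X_def)
    qed
    finally show ?thesis .
  qed
  \<comment> \<open>Induction downwards from \<open>N\<close>, starting from the vanishing
    coordinate \<open>X (N + 1)\<close>. The inequality \<open>X n \<le> X (n - 1)\<close> feeds the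
    next step down; the weighted one is the decay.\<close>
  have dec: "X n \<le> X (n - 1) \<and> 3 * (a n * X n) \<le> a (n - 1) * X (n - 1)"
    if "n0 < n" "n \<le> N" for n
    using that
  proof (induction "N - n" arbitrary: n rule: less_induct)
    case less
    define c where "c = norm (b n - z)"
    have c: "4 * a n \<le> c" "4 * a (n - 1) \<le> c" using dom[OF less.prems] by (auto simp: c_def)
    have an: "a n > 0" using a_pos[of n] less.prems n0 by simp
    have "X (n + 1) \<le> X n"
    proof (cases "n = N")
      case True
      then show ?thesis using cinner_H_above[OF x, of "n + 1"] X0[of n] by (simp add: X_def)
    next
      case False
      then show ?thesis using less.hyps[of "n + 1"] less.prems by simp
    qed
    then have "a n * X (n + 1) \<le> a n * X n" using an by simp
    then have main: "(c - a n) * X n \<le> a (n - 1) * X (n - 1)"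
      using step[OF less.prems] by (simp add: c_def algebra_simps)
    \<comment> \<open>From \<open>4 * a n \<le> c\<close>, the factor \<open>c - a n\<close> is at
      least \<open>3 * a n\<close> and at least \<open>3 / 4 * c\<close>. The first bound yields the
      ratio 1/3, the second the monotonicity.\<close>
    have "3 * a n * X n \<le> (c - a n) * X n"
      using c X0 by (intro mult_right_mono) auto
    moreover have "3 / 4 * c * X n \<le> (c - a n) * X n"
      using c X0 by (intro mult_right_mono) auto
    moreover have "a (n - 1) * X (n - 1) \<le> c / 4 * X (n - 1)"
      using c X0 by (intro mult_right_mono) auto
    ultimately have 1: "3 * (a n * X n) \<le> a (n - 1) * X (n - 1)"
      and 2: "3 / 4 * c * X n \<le> c / 4 * X (n - 1)" using main by linarith+
    have "c * (3 * X n) \<le> c * X (n - 1)" using 2 by simp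
    then have "3 * X n \<le> X (n - 1)" using c(1) an by simp
    then show ?case using 1 X0[of n] by simp
  qed
  have "a n * X n \<le> (1 / 3) ^ (n - n0) * (a n0 * X n0)" if "n0 \<le> n" "n \<le> N" for n
    using that
  proof (induction n rule: dec_induct)
    case (step n)
    have "a (Suc n) * X (Suc n) \<le> 1 / 3 * (a n * X n)"
      using dec[of "Suc n"] step by simp
    also have "\<dots> \<le> 1 / 3 * ((1 / 3) ^ (n - n0) * (a n0 * X n0))"
      using step by simp
    finally show ?case using step by (simp add: Suc_diff_le)
  qed simp
  from this[OF n0(2) order_refl]
  have "a N * X N \<le> (1 / 3) ^ (N - n0) * (a n0 * X n0)" .
  also have "\<dots> \<le> (1 / 3) ^ (N - n0) * (a n0 * norm x)"
    using norm_cinner_basis_le[OF n0(1), of x] a_pos[OF n0(1)]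
    by (intro mult_left_mono) (auto simp: X_def)
  finally show ?thesis by (simp add: X_def)
qed


section \<open>Density of the domain and spectra of the truncations\<close>

lemma dense_if_basis:
  assumes "complex_vector.subspace D" and "\<And>n. n \<ge> 1 \<Longrightarrow> e n \<in> closure D"
  shows "closure D = UNIV"
proof -
  have "cspan (e ` {1..}) \<subseteq> closure D"
    using assms(2) by (intro complex_vector.span_minimal subspace_closure assms(1)) auto
  then have "closure (cspan (e ` {1..})) \<subseteq> closure D"
    by (rule closure_minimal) simp
  then show ?thesis using basis by (simp add: orthonormal_basis_def top.extremum_unique)
qed

lemma dense_domain: "closure (fst ` T) = UNIV"
proof (rule dense_if_basis)
  show "complex_vector.subspace (fst ` T)"
    unfolding complex_vector.subspace_def
  proof (intro conjI ballI allI)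
    have "(0, 0) \<in> T" using linear_graph_T by (simp add: linear_graph_def)
    then show "0 \<in> fst ` T" by (rule rev_image_eqI) simp
  next
    fix x y assume "x \<in> fst ` T" "y \<in> fst ` T"
    then obtain u v where "(x, u) \<in> T" "(y, v) \<in> T" by auto
    then have "(x + y, u + v) \<in> T" using linear_graph_T unfolding linear_graph_def by blast
    then show "x + y \<in> fst ` T" by (rule rev_image_eqI) simp
  next
    fix c x assume "x \<in> fst ` T"
    then obtain u where "(x, u) \<in> T" by auto
    then have "(c *\<^sub>C x, c *\<^sub>C u) \<in> T" using linear_graph_T unfolding linear_graph_def by blast
    then show "c *\<^sub>C x \<in> fst ` T" by (rule rev_image_eqI) simp
  qed
next
  fix n :: nat assume "n \<ge> 1"
  then have "(e n, J n (e n)) \<in> T" by (intro J_in_T H_basis) auto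
  then have "e n \<in> fst ` T" by force
  then show "e n \<in> closure (fst ` T)" by (rule subsetD[OF closure_subset])
qed

lemma cinner_A_real: "x \<in> H N \<Longrightarrow> Im (cinner (A N x) x) = 0"
proof -
  assume "x \<in> H N"
  then have "cinner (A N x) x = cinner x (A N x)" by (intro A_symmetric)
  also have "\<dots> = cnj (cinner (A N x) x)" by (rule cinner_commute)
  finally show ?thesis by (metis cnj.simps(2) neg_equal_zero)
qed

text \<open>Single-valuedness makes \<open>J N x\<close> the only value of \<open>T\<close> at
  \<open>x\<close>, so the set in \<open>truncation\<close> becomes the graph of \<open>A N\<close>
  on \<open>H N\<close>.\<close>

lemma truncation_eq:
  assumes "single_valued T"
  shows "truncation e T N = (\<lambda>x. (x, A N x)) ` H N"
proof -
  have "u = J N x" if "x \<in> H N" "(x, u) \<in> T" for x u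
    using assms J_in_T[OF that(1)] that(2) by (auto dest: single_valuedD)
  then show ?thesis
    unfolding truncation_def using J_in_T
    by (auto simp: orth_proj_H P_id A_def image_iff) blast
qed

text \<open>On the finite-dimensional \<open>H N\<close> injectivity of \<open>f\<close> already
  gives surjectivity and a bounded inverse, so only a kernel can put \<open>z\<close> into the
  spectrum.\<close>

lemma spectrum_truncation:
  assumes "single_valued T"
  shows "z \<in> op_spectrum (H N) (truncation e T N) \<longleftrightarrow> (\<exists>x\<in>H N. x \<noteq> 0 \<and> A N x = z *\<^sub>C x)"
proof -
  define f where "f = (\<lambda>x. A N x - z *\<^sub>C x)"
  have lin: "Vector_Spaces.linear scaleC scaleC f"
    unfolding f_def by (rule linear_shift[OF linear_A])
  interpret f: Vector_Spaces.linear scaleC scaleC f by (rule lin)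
  have f_H: "f x \<in> H N" if "x \<in> H N" for x
    unfolding f_def by (intro H_diff A_in_H H_scale that)
  have "bij_betw (\<lambda>(x, u). u - z *\<^sub>C x) (truncation e T N) (H N) \<longleftrightarrow> bij_betw f (H N) (H N)"
  proof -
    have "bij_betw (\<lambda>x. (x, A N x)) (H N) (truncation e T N)"
      unfolding truncation_eq[OF assms] by (intro inj_on_imp_bij_betw inj_onI) simp
    from bij_betw_comp_iff[OF this, of "\<lambda>(x, u). u - z *\<^sub>C x" "H N"]
    show ?thesis by (simp add: f_def comp_def)
  qed
  then have res: "z \<in> resolvent_set (H N) (truncation e T N) \<longleftrightarrow>
      bij_betw f (H N) (H N) \<and> (\<exists>C. \<forall>x\<in>H N. norm x \<le> C * norm (f x))"
    unfolding resolvent_set_def by (simp add: truncation_eq[OF assms] f_def)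
  have "z \<in> resolvent_set (H N) (truncation e T N) \<longleftrightarrow> (\<forall>x\<in>H N. f x = 0 \<longrightarrow> x = 0)"
  proof
    assume "z \<in> resolvent_set (H N) (truncation e T N)"
    then have "inj_on f (H N)" using res by (simp add: bij_betw_def)
    then show "\<forall>x\<in>H N. f x = 0 \<longrightarrow> x = 0"
      using H_0 f.zero by (metis inj_onD)
  next
    assume "\<forall>x\<in>H N. f x = 0 \<longrightarrow> x = 0"
    then have inj: "x = 0" if "x \<in> H N" "f x = 0" for x using that by blast
    have "inj_on f (H N)"
      using inj by (intro inj_onI) (metis H_diff eq_iff_diff_eq_0 f.diff)
    moreover have "f ` H N = H N"
    proof (intro equalityI subsetI)
      fix y assume "y \<in> H N"
      from injective_on_H(1)[OF lin f_H inj this] show "y \<in> f ` H N" by (auto simp only: image_iff)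
    qed (use f_H in auto)
    ultimately have "bij_betw f (H N) (H N)" by (simp add: bij_betw_def)
    moreover have "\<exists>C. \<forall>x\<in>H N. norm x \<le> C * norm (f x)"
      using injective_on_H(2)[OF lin f_H inj] by blast
    ultimately show "z \<in> resolvent_set (H N) (truncation e T N)" using res by blast
  qed
  then show ?thesis by (auto simp: op_spectrum_def f_def)
qed

end

subsection \<open>Dominant diagonal\<close>

text \<open>The little-o conditions with exponent 1, which \<open>powr_less_1_little_o\<close>
  derives from those with \<open>r < 1\<close>.\<close>

locale dominated_jacobi = jacobi +
  assumes b_lim: "filterlim (\<lambda>n. \<bar>b n\<bar>) at_top sequentially"
    and a_lim: "(\<lambda>n. a n / \<bar>b n\<bar>) \<longlonglongrightarrow> 0"
    and a_lim': "(\<lambda>n. a (n - 1) / \<bar>b n\<bar>) \<longlonglongrightarrow> 0"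
begin

text \<open>Uniformity in \<open>z\<close> over a disc allows its use for eigenvalues that vary with
  \<open>N\<close>; \<open>k\<close> lets \<open>n0\<close> be pushed beyond a given basis
  index.\<close>

lemma diagonal_dominates:
  "\<exists>n0\<ge>max k 1. \<forall>n>n0. \<forall>z::complex. norm z \<le> M \<longrightarrow>
    4 * a n \<le> norm (b n - z) \<and> 4 * a (n - 1) \<le> norm (b n - z)"
proof -
  \<comment> \<open>Beyond \<open>2 * M\<close> the distance from \<open>b n\<close> to the disc is
    at least half of \<open>\<bar>b n\<bar>\<close>, so 1/8 below becomes the factor 4. The 1 keeps
    \<open>b n\<close> nonzero for the division.\<close>
  have "\<forall>\<^sub>F n in sequentially. \<bar>b n\<bar> > max 1 (2 * M)"
    using b_lim unfolding filterlim_at_top_dense by blast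
  moreover have "\<forall>\<^sub>F n in sequentially. a n / \<bar>b n\<bar> < 1 / 8"
    by (rule order_tendstoD(2)[OF a_lim]) simp
  moreover have "\<forall>\<^sub>F n in sequentially. a (n - 1) / \<bar>b n\<bar> < 1 / 8"
    by (rule order_tendstoD(2)[OF a_lim']) simp
  ultimately have "\<forall>\<^sub>F n in sequentially. \<forall>z::complex. norm z \<le> M \<longrightarrow>
      4 * a n \<le> norm (b n - z) \<and> 4 * a (n - 1) \<le> norm (b n - z)"
  proof eventually_elim
    case (elim n)
    show ?case
    proof (intro allI impI)
      fix z :: complex assume z: "norm z \<le> M"
      have "\<bar>b n\<bar> - norm z \<le> norm (b n - z)"
        using norm_triangle_ineq2[of "complex_of_real (b n)" z] by simp
      moreover have "8 * a n \<le> \<bar>b n\<bar>" "8 * a (n - 1) \<le> \<bar>b n\<bar>"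
        using elim by (auto simp: field_simps)
      ultimately show "4 * a n \<le> norm (b n - z) \<and> 4 * a (n - 1) \<le> norm (b n - z)"
        using elim z by auto
    qed
  qed
  then obtain m where m: "\<And>n (z::complex). n \<ge> m \<Longrightarrow> norm z \<le> M \<Longrightarrow>
      4 * a n \<le> norm (b n - z) \<and> 4 * a (n - 1) \<le> norm (b n - z)"
    unfolding eventually_sequentially by blast
  show ?thesis
    by (rule exI[of _ "max m (max k 1)"]) (use m in auto)
qed

lemma dense_range:
  assumes z: "Im z \<noteq> 0"
  shows "closure ((\<lambda>(x, u). u - z *\<^sub>C x) ` T) = UNIV" (is "closure ?R = UNIV")
proof (rule dense_if_basis)
  show "complex_vector.subspace ?R"
    unfolding complex_vector.subspace_def
  proof (intro conjI ballI allI)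
    have "(0, 0) \<in> T" using linear_graph_T by (simp add: linear_graph_def)
    then show "0 \<in> ?R" by (rule rev_image_eqI) simp
  next
    fix y y' assume "y \<in> ?R" "y' \<in> ?R"
    then obtain x u x' u' where "(x, u) \<in> T" "y = u - z *\<^sub>C x" "(x', u') \<in> T" "y' = u' - z *\<^sub>C x'"
      by auto
    then show "y + y' \<in> ?R"
      using linear_graph_T unfolding linear_graph_def
      by (intro rev_image_eqI[of "(x + x', u + u')"]) (auto simp: scaleC_add_right)
  next
    fix c y assume "y \<in> ?R"
    then obtain x u where "(x, u) \<in> T" "y = u - z *\<^sub>C x" by auto
    then show "c *\<^sub>C y \<in> ?R"
      using linear_graph_T unfolding linear_graph_def
      by (intro rev_image_eqI[of "(c *\<^sub>C x, c *\<^sub>C u)"])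
        (auto simp: scaleC.diff_right scaleC_scaleC mult.commute)
  qed
next
  fix k :: nat assume k: "k \<ge> 1"
  \<comment> \<open>With \<open>n0 \<ge> k\<close> the right-hand side \<open>e k\<close> has no
    coordinates above \<open>n0\<close>, so the homogeneous recurrence of
    \<open>truncation_tail\<close> holds there.\<close>
  obtain n0 where n0: "n0 \<ge> k" "n0 \<ge> 1" and dom: "\<And>n (w::complex). n0 < n \<Longrightarrow> norm w \<le> norm z \<Longrightarrow>
      4 * a n \<le> norm (b n - w) \<and> 4 * a (n - 1) \<le> norm (b n - w)"
    using diagonal_dominates[of k "norm z"] by (metis max.bounded_iff)
  \<comment> \<open>The factor \<open>1 / \<bar>Im z\<bar>\<close> bounds every truncated solution,
    whatever \<open>N\<close> is, so one constant serves all \<open>i\<close>.\<close>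
  define K where "K = a n0 * (1 / \<bar>Im z\<bar>)"
  have "\<exists>y. y \<in> ?R \<and> norm (y - e k) \<le> (1 / 3) ^ i * K" for i
  proof -
    define N where "N = n0 + i"
    have N: "n0 \<le> N" "k \<le> N" "N \<ge> 1" using n0 by (auto simp: N_def)
    have below: "\<bar>Im z\<bar> * norm x \<le> norm (A N x - z *\<^sub>C x)" if "x \<in> H N" for x
      by (rule norm_shift_ge[OF cinner_A_real[OF that]])
    have "\<exists>x\<in>H N. A N x - z *\<^sub>C x = e k"
    proof (rule injective_on_H(1)[OF linear_shift[OF linear_A]])
      show "A N x - z *\<^sub>C x \<in> H N" if "x \<in> H N" for x
        by (intro H_diff A_in_H H_scale that)
      show "x = 0" if "x \<in> H N" "A N x - z *\<^sub>C x = 0" for x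
        using below[OF that(1)] that(2) z by (simp add: mult_le_0_iff)
      show "e k \<in> H N" by (rule H_basis[OF k N(2)])
    qed
    then obtain x where x: "x \<in> H N" "A N x - z *\<^sub>C x = e k" by blast
    have "norm x \<le> 1 / \<bar>Im z\<bar>"
      using below[OF x(1)] z by (simp add: x(2) norm_basis[OF k] field_simps)
    then have "a n0 * norm x \<le> K"
      using a_pos[OF n0(2)] by (simp add: K_def mult_left_mono del: times_divide_eq_right)
    have "a N * norm (cinner x (e N)) \<le> (1 / 3) ^ (N - n0) * (a n0 * norm x)"
    proof (rule truncation_tail[OF x(1) n0(2) N(1) dom[OF _ order_refl]])
      fix n assume n: "n0 < n" "n \<le> N"
      have "cinner (A N x - z *\<^sub>C x) (e n) = 0"
        unfolding x(2) using n n0 k by (simp add: cinner_basis)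
      then show "cinner (A N x) (e n) = z * cinner x (e n)"
        by (simp add: cinner.diff_left cinner_scaleC_left)
    qed
    also have "\<dots> \<le> (1 / 3) ^ i * K"
      unfolding N_def using \<open>a n0 * norm x \<le> K\<close> by (simp add: mult_left_mono)
    finally have "a N * norm (cinner x (e N)) \<le> (1 / 3) ^ i * K" .
    moreover have "(J N x - z *\<^sub>C x) - e k = (a N * cinner x (e N)) *\<^sub>C e (N + 1)"
      by (simp add: J_eq_A[OF x(1) N(3)] x(2)[symmetric])
    ultimately have "norm ((J N x - z *\<^sub>C x) - e k) \<le> (1 / 3) ^ i * K"
      using a_pos[OF N(3)] by (simp add: norm_scaleC norm_mult norm_basis)
    moreover have "J N x - z *\<^sub>C x \<in> ?R"
      using J_in_T[OF x(1)] by (intro rev_image_eqI) auto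
    ultimately show ?thesis by blast
  qed
  then obtain y where y: "\<And>i. y i \<in> ?R" "\<And>i. norm (y i - e k) \<le> (1 / 3) ^ i * K" by metis
  have "y \<longlonglongrightarrow> e k"
  proof (rule LIM_zero_cancel, rule Lim_null_comparison)
    show "\<forall>\<^sub>F i in sequentially. norm (y i - e k) \<le> (1 / 3) ^ i * K" using y(2) by simp
    show "(\<lambda>i. (1 / 3) ^ i * K) \<longlonglongrightarrow> 0"
      by (intro tendsto_mult_left_zero LIMSEQ_power_zero) simp
  qed
  then show "e k \<in> closure ?R" unfolding closure_sequential using y(1) by blast
qed

section \<open>Self-adjointness and reality of the spectrum\<close>

lemma shift_surj:
  assumes "Im z \<noteq> 0"
  shows "\<exists>(x, u)\<in>T. u - z *\<^sub>C x = y"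
  by (rule symmetric_nonreal_resolvent(1)[OF linear_graph_T closed_T symmetric_graph_T assms
        dense_range[OF assms]])

lemma self_adjoint_T: "self_adjoint T"
  by (rule self_adjointI[OF linear_graph_T symmetric_graph_T dense_domain shift_surj])

lemma single_valued_T: "single_valued T"
  using self_adjoint_T unfolding self_adjoint_def is_operator_def by (elim conjE)

lemma spectrum_real:
  assumes "z \<in> op_spectrum UNIV T"
  shows "Im z = 0"
proof (rule ccontr)
  assume z: "Im z \<noteq> 0"
  have "z \<in> resolvent_set UNIV T"
    by (rule symmetric_nonreal_resolvent(2)[OF linear_graph_T closed_T symmetric_graph_T z
          dense_range[OF z]])
  then show False using assms by (simp add: op_spectrum_def)
qed

text \<open>Otherwise \<open>T - z\<close> is bounded below on \<open>S\<close>, hence by limits on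
  its closure \<open>T\<close>; as \<open>z\<close> is real, \<open>symmetric_real_resolvent\<close>
  would put it into the resolvent set.\<close>

lemma approximate_eigenvector:
  assumes z: "z \<in> op_spectrum UNIV T" and d: "d > 0"
  shows "\<exists>N. \<exists>x\<in>H N. norm (J N x - z *\<^sub>C x) < d * norm x"
proof (rule ccontr)
  assume "\<not> ?thesis"
  then have S: "d * norm x \<le> norm (u - z *\<^sub>C x)" if "(x, u) \<in> S" for x u
    using that unfolding mem_S_iff by (auto simp: not_less)
  have "d * norm x \<le> norm (u - z *\<^sub>C x)" if xu: "(x, u) \<in> T" for x u
  proof -
    obtain f g where fg: "\<And>n. (f n, g n) \<in> S" "f \<longlonglongrightarrow> x" "g \<longlonglongrightarrow> u"
      using xu unfolding tridiag_def closure_Pair_sequential by auto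
    have "(\<lambda>n. d * norm (f n)) \<longlonglongrightarrow> d * norm x"
      by (intro tendsto_intros fg)
    moreover have "(\<lambda>n. norm (g n - z *\<^sub>C f n)) \<longlonglongrightarrow> norm (u - z *\<^sub>C x)"
      by (intro tendsto_intros tendsto_scaleC fg)
    ultimately show ?thesis
      by (rule LIMSEQ_le) (use S fg(1) in blast)
  qed
  from symmetric_real_resolvent[OF linear_graph_T closed_T symmetric_graph_T shift_surj
      spectrum_real[OF z] d this]
  show False using z by (simp add: op_spectrum_def)
qed

section \<open>The two inclusions between spectrum and limit spectrum\<close>

lemma spectrum_subset_limit_spectrum: "op_spectrum UNIV T \<subseteq> limit_spectrum e T"
proof
  fix z assume z: "z \<in> op_spectrum UNIV T"
  define r where "r = Re z"
  have zr: "z = complex_of_real r" using spectrum_real[OF z] by (simp add: r_def complex_eq_iff)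
  \<comment> \<open>Take for each \<open>N\<close> an eigenvalue nearest to \<open>z\<close>: its
    distance from \<open>z\<close> is at most the relative residual of any test vector in
    \<open>H N\<close>.\<close>
  have "\<exists>l. l \<in> op_spectrum (H N) (truncation e T N) \<and>
      (\<forall>y\<in>H N. norm (l - z) * norm y \<le> norm (A N y - z *\<^sub>C y))" if N: "N \<ge> 1" for N
  proof -
    obtain l x where "x \<in> H N" "x \<noteq> 0" "A N x = l *\<^sub>C x"
      and "\<forall>y\<in>H N. norm (l - z) * norm y \<le> norm (A N y - z *\<^sub>C y)"
      using nearest_eigenvalue[OF N, of r] unfolding zr by metis
    then show ?thesis
      unfolding spectrum_truncation[OF single_valued_T] by (intro exI[of _ l]) metis
  qed
  then obtain l where l: "\<And>N. N \<ge> 1 \<Longrightarrow> l N \<in> op_spectrum (H N) (truncation e T N)"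
    and l_le: "\<And>N y. N \<ge> 1 \<Longrightarrow> y \<in> H N \<Longrightarrow> norm (l N - z) * norm y \<le> norm (A N y - z *\<^sub>C y)"
    by metis
  have "l \<longlonglongrightarrow> z"
  proof (rule metric_LIMSEQ_I)
    fix d :: real assume "d > 0"
    then obtain M x where x: "x \<in> H M" "norm (J M x - z *\<^sub>C x) < d * norm x"
      using approximate_eigenvector[OF z] by blast
    have x0: "norm x > 0" using x(2) by (cases "x = 0") (auto simp: J_def)
    have "dist (l N) z < d" if N: "N \<ge> M + 1" for N
    proof -
      \<comment> \<open>\<open>J M x\<close> may reach into \<open>H (M + 1)\<close>, hence the
        bound \<open>N \<ge> M + 1\<close>; from there on truncation leaves the image of
        \<open>x\<close> unchanged.\<close>
      have "J M x \<in> H N" using J_in_H[of M x] H_mono[OF N] by auto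
      then have "A N x = J M x"
        using J_mono[OF x(1), of N] N by (simp add: A_def P_id)
      moreover have "x \<in> H N" using x(1) H_mono[of M N] N by auto
      ultimately have "norm (l N - z) * norm x < d * norm x"
        using l_le[of N x] N x(2) by simp
      then show ?thesis using x0 by (simp add: dist_norm)
    qed
    then show "\<exists>M. \<forall>N\<ge>M. dist (l N) z < d" by blast
  qed
  \<comment> \<open>The whole sequence converges, so the identity serves as subsequence.\<close>
  then have "\<exists>s :: nat \<Rightarrow> nat. strict_mono s \<and> (l \<circ> s) \<longlonglongrightarrow> z"
    by (intro exI[of _ id]) (auto simp: strict_mono_def)
  then show "z \<in> limit_spectrum e T"
    unfolding limit_spectrum_def using l by blast
qed

lemma limit_spectrum_subset_spectrum: "limit_spectrum e T \<subseteq> op_spectrum UNIV T"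
proof
  fix z assume "z \<in> limit_spectrum e T"
  then obtain l s where l: "\<And>N. N \<ge> 1 \<Longrightarrow> l N \<in> op_spectrum (H N) (truncation e T N)"
    and s: "strict_mono (s :: nat \<Rightarrow> nat)" "(l \<circ> s) \<longlonglongrightarrow> z"
    unfolding limit_spectrum_def by blast
  have lim: "(\<lambda>j. l (s j)) \<longlonglongrightarrow> z" using s(2) by (simp add: comp_def)
  show "z \<in> op_spectrum UNIV T"
  proof (rule ccontr)
    assume "z \<notin> op_spectrum UNIV T"
    then have "z \<in> resolvent_set UNIV T" by (simp add: op_spectrum_def)
    then obtain C where C: "\<And>x u. (x, u) \<in> T \<Longrightarrow> norm x \<le> C * norm (u - z *\<^sub>C x)"
      unfolding resolvent_set_def by blast
    \<comment> \<open>The disc of this radius contains the eigenvalues \<open>l (s j)\<close> for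
      all large \<open>j\<close>.\<close>
    define M where "M = norm z + 1"
    obtain n0 where n0: "n0 \<ge> 1" and dom: "\<And>n (w::complex). n0 < n \<Longrightarrow> norm w \<le> M \<Longrightarrow>
        4 * a n \<le> norm (b n - w) \<and> 4 * a (n - 1) \<le> norm (b n - w)"
      using diagonal_dominates[of 1 M] by (metis max.bounded_iff)
    \<comment> \<open>Relative residual at \<open>z\<close> of an eigenvector of the section of size
      \<open>s j\<close>: distance of its eigenvalue from \<open>z\<close> plus truncation error. It
      tends to 0, against the resolvent bound \<open>C\<close>.\<close>
    define K where "K = (\<lambda>j. norm (l (s j) - z) + (1 / 3) ^ (s j - n0) * a n0)"
    \<comment> \<open>The absolute value appears because the sign of \<open>C\<close> is not
      given.\<close>
    have K_ge: "1 \<le> \<bar>C\<bar> * K j" if j: "j \<ge> n0" "norm (l (s j)) \<le> M" for j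
    proof -
      define N where "N = s j"
      have N: "n0 \<le> N" "N \<ge> 1" using j(1) n0 seq_suble[OF s(1), of j] by (auto simp: N_def)
      obtain x where x: "x \<in> H N" "x \<noteq> 0" "A N x = l N *\<^sub>C x"
        using l[OF N(2)] unfolding spectrum_truncation[OF single_valued_T] by blast
      have "a N * norm (cinner x (e N)) \<le> (1 / 3) ^ (N - n0) * (a n0 * norm x)"
        using j(2) by (intro truncation_tail[OF x(1) n0 N(1) dom, of "l N"])
          (auto simp: x(3) cinner_scaleC_left N_def[symmetric])
      moreover have "J N x - z *\<^sub>C x = (l N - z) *\<^sub>C x + (a N * cinner x (e N)) *\<^sub>C e (N + 1)"
        by (simp add: J_eq_A[OF x(1) N(2)] x(3) scaleC.diff_left)
      ultimately have "norm (J N x - z *\<^sub>C x) \<le>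
          norm (l N - z) * norm x + (1 / 3) ^ (N - n0) * (a n0 * norm x)"
        using a_pos[OF N(2)] norm_triangle_ineq[of "(l N - z) *\<^sub>C x"
            "(a N * cinner x (e N)) *\<^sub>C e (N + 1)"]
        by (simp add: norm_scaleC norm_mult norm_basis)
      also have "\<dots> = K j * norm x" by (simp add: K_def N_def algebra_simps)
      finally have "\<bar>C\<bar> * norm (J N x - z *\<^sub>C x) \<le> \<bar>C\<bar> * (K j * norm x)"
        by (rule mult_left_mono) simp
      moreover have "norm x \<le> \<bar>C\<bar> * norm (J N x - z *\<^sub>C x)"
        by (rule order_trans[OF C[OF J_in_T[OF x(1)]] mult_right_mono]) auto
      ultimately have "1 * norm x \<le> (\<bar>C\<bar> * K j) * norm x" by (simp add: mult.assoc)
      then show ?thesis using x(2) by (simp only: mult_le_cancel_right) simp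
    qed
    have "\<forall>\<^sub>F j in sequentially. norm (l (s j)) < M"
      by (rule order_tendstoD(2)[OF tendsto_norm[OF lim]]) (simp add: M_def)
    then have "\<forall>\<^sub>F j in sequentially. 1 \<le> \<bar>C\<bar> * K j"
      using eventually_ge_at_top[of n0] by eventually_elim (simp add: K_ge)
    moreover have "(\<lambda>j. \<bar>C\<bar> * K j) \<longlonglongrightarrow> \<bar>C\<bar> * (norm (z - z) + 0 * a n0)"
    proof -
      have "(\<lambda>n. (1 / 3 :: real) ^ (n - n0)) \<longlonglongrightarrow> 0"
        by (rule LIMSEQ_offset[of _ n0]) (simp add: LIMSEQ_power_zero)
      then have "(\<lambda>j. (1 / 3 :: real) ^ (s j - n0)) \<longlonglongrightarrow> 0"
        using LIMSEQ_subseq_LIMSEQ[OF _ s(1)] by (fastforce simp: comp_def)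
      then show ?thesis unfolding K_def by (intro tendsto_intros lim)
    qed
    ultimately have "1 \<le> \<bar>C\<bar> * (norm (z - z) + 0 * a n0)"
      by (intro tendsto_lowerbound) auto
    then show False by simp
  qed
qed

end

section \<open>Reduction of the growth condition and conclusion\<close>

lemma powr_less_1_little_o:
  fixes a b :: "nat \<Rightarrow> real"
  assumes b: "filterlim (\<lambda>n. \<bar>b n\<bar>) at_top sequentially" and r: "r < 1"
    and a: "(\<lambda>n. a n / \<bar>b n\<bar> powr r) \<longlonglongrightarrow> 0"
  shows "(\<lambda>n. a n / \<bar>b n\<bar>) \<longlonglongrightarrow> 0"
proof -
  \<comment> \<open>The exponent \<open>r - 1\<close> is negative, and multiplying by this null
    sequence replaces the power \<open>r\<close> by 1 in the denominator.\<close>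
  have "((\<lambda>n. \<bar>b n\<bar> powr (r - 1)) \<longlongrightarrow> 0) sequentially"
    by (rule tendsto_neg_powr[OF _ b]) (use r in simp)
  then have "(\<lambda>n. a n / \<bar>b n\<bar> powr r * \<bar>b n\<bar> powr (r - 1)) \<longlonglongrightarrow> 0"
    using tendsto_mult[OF a] by fastforce
  moreover have "\<forall>\<^sub>F n in sequentially. \<bar>b n\<bar> > 0"
    using b unfolding filterlim_at_top_dense by blast
  then have "\<forall>\<^sub>F n in sequentially. a n / \<bar>b n\<bar> powr r * \<bar>b n\<bar> powr (r - 1) = a n / \<bar>b n\<bar>"
    by eventually_elim (simp add: powr_diff)
  ultimately show ?thesis by (rule Lim_transform_eventually)
qed

theorem theorem3p4:
  fixes e :: "nat \<Rightarrow> 'a::complex_hilbert" and a b :: "nat \<Rightarrow> real" and r :: real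
  assumes "orthonormal_basis e"
    and "\<And>n. n \<ge> 1 \<Longrightarrow> a n > 0"
    and "filterlim (\<lambda>n. \<bar>b n\<bar>) at_top sequentially"
    and "r < 1"
    and "(\<lambda>n. a n / \<bar>b n\<bar> powr r) \<longlonglongrightarrow> 0"
    and "(\<lambda>n. a (n - 1) / \<bar>b n\<bar> powr r) \<longlonglongrightarrow> 0"
  shows "self_adjoint (tridiag a b e) \<and>
    limit_spectrum e (tridiag a b e) = op_spectrum UNIV (tridiag a b e)"
proof -
  interpret dominated_jacobi e a b
    using assms(1-3) powr_less_1_little_o[OF assms(3,4,5)] powr_less_1_little_o[OF assms(3,4,6)]
    by unfold_locales
  show ?thesis
    using self_adjoint_T limit_spectrum_subset_spectrum spectrum_subset_limit_spectrum by blast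
qed

end
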